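(* Let $\alpha\in[0,1)$ and $\epsilon>0$ be constants. Consider the expandable Count-Min sketch $\mathrm{Sublime}_{\mathrm{CMS}}$ (described in the context) with a single array and size function $W(\cdot)$, run on a stream whose current total key count is $N$, and let $E(N)=\hat f(x)-f(x)$ be the estimation error for a queried key $x$. Then $$\mathbb{E}[E(N)]\le\begin{cases} O(1)\cdot \epsilon N^{1-\alpha} & \text{if } W(N)=N^{\alpha}/\epsilon,\\ \log_2 N\cdot \epsilon & \text{if } W(N)=N/\epsilon,\end{cases}$$ where the $O(1)$ constant depends only on $\alpha$. Moreover, compared to a fixed-size Count-Min sketch allocated upfront with a single array of $W(N)$ counters with knowledge of $N$, the expected error terms above are higher by at most a constant factor (sublinear case) and a logarithmic factor (linear case).
   Context: Stream model: keys come from a universe $U$; the stream is a sequence of updates $(x,\Delta)$ with $\Delta\in\{+1,-1\}$ (insertion or deletion of a previously inserted key); $f(x)$ denotes the current count of $x$ (insertions minus deletions, always $\ge 0$) and $N=\sum_x f(x)$ the current total key count. A (fixed-size) Count-Min sketch with one array of $w$ counters uses a hash function $h$ mapping keys to $\{0,\dots,w-1\}$ (pairwise independent, uniform); an update $(x,\Delta)$ adds $\Delta$ to counter $h(x)$, and the estimate $\hat f(x)$ is the value of counter $h(x)$. $\mathrm{Sublime}_{\mathrm{CMS}}$ with one array and size function $W$ (a function giving the desired number of counters as a function of $N$): a single hash function $h$ mapping keys to long bit strings is used throughout, with the $m$ lowest-order bits of $h(x)$ uniform and pairwise independent across distinct keys for every $m$. The array initially has $w_0$ counters (a power of two). Each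 time $W(N)$ doubles relative to the previous expansion (for $W(N)=N^\alpha/\epsilon$ this is each time $N$ grows by a factor $2^{1/\alpha}$; for $W(N)=N/\epsilon$ each time $N$ doubles), the structure expands: the array of $w$ counters is replaced by its concatenation with a copy of itself (the counter at index $j+w$ is set equal to the counter at index $j$), so after $i$ expansions there are $2^i w_0$ counters. With an array of $w$ counters, key $x$ is mapped to the counter indexed by the $\log_2 w$ lowest-order bits of $h(x)$; updates add $\Delta$ to that counter and the estimate $\hat f(x)$ is its value. (On deletions, the state before each expansion is recorded; when $N$ drops below the average of the two previous expansion thresholds the structure contracts by subtracting the recorded earlier state from each half of the current array and adding the resulting deltas to the recorded earlier state, which then replaces the current array.) Expectations are over the randomness of $h$.
   Formalization: The initial array is assumed to have w_0 ≥ W(N_0) counters for an integer initial reference count N_0 ≥ 1; the linear case assumes N ≥ 2, and its bound log_2 N · ε with constant exactly 1 assumes N_0 ≥ 2 (for N_0 = 1 only C·log_2 N · ε with absolute C). *)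

theory Defs
  imports "HOL-Probability.Probability" "HOL-Library.Discrete_Functions"
begin

section \<open>Streams\<close>

text \<open>A stream is the list of its updates (key, increment), oldest first.\<close>

type_synonym 'k stream = "('k \<times> int) list"

definition freq :: "'k stream \<Rightarrow> 'k \<Rightarrow> int" where
  "freq s x = (\<Sum>(y, d)\<leftarrow>s. if y = x then d else 0)"

definition key_count :: "'k stream \<Rightarrow> int" where
  "key_count s = (\<Sum>x\<in>fst ` set s. freq s x)"

text \<open>Every update is an insertion or a deletion of a key that is currently present.\<close>

definition valid_stream :: "'k stream \<Rightarrow> bool" where
  "valid_stream s \<longleftrightarrow>
     (\<forall>(x, d)\<in>set s. d = 1 \<or> d = -1) \<and>
     (\<forall>n\<le>length s. \<forall>x. 0 \<le> freq (take n s) x)"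

section \<open>Hash functions\<close>

text \<open>A random function from keys to \<open>{0..<w}\<close>, uniform and pairwise independent.\<close>

definition pairwise_hash :: "'w measure \<Rightarrow> nat \<Rightarrow> ('w \<Rightarrow> 'k \<Rightarrow> nat) \<Rightarrow> bool" where
  "pairwise_hash M w g \<longleftrightarrow>
     prob_space M \<and>
     (\<forall>x. (\<lambda>\<omega>. g \<omega> x) \<in> measurable M (count_space UNIV)) \<and>
     (\<forall>x. \<forall>\<omega>\<in>space M. g \<omega> x < w) \<and>
     (\<forall>x. \<forall>v<w. measure M {\<omega> \<in> space M. g \<omega> x = v} = 1 / real w) \<and>
     (\<forall>x y. x \<noteq> y \<longrightarrow>
        prob_space.indep_var M (count_space UNIV) (\<lambda>\<omega>. g \<omega> x) (count_space UNIV) (\<lambda>\<omega>. g \<omega> y))"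

text \<open>Bit strings are infinite, least significant bit first, so that the hash function never
  runs out of bits however often the array is expanded.\<close>

definition low_bits :: "nat \<Rightarrow> (nat \<Rightarrow> bool) \<Rightarrow> nat" where
  "low_bits m b = (\<Sum>j<m. of_bool (b j) * 2 ^ j)"

definition bitstring_hash :: "'w measure \<Rightarrow> ('w \<Rightarrow> 'k \<Rightarrow> nat \<Rightarrow> bool) \<Rightarrow> bool" where
  "bitstring_hash M h \<longleftrightarrow> (\<forall>m. pairwise_hash M (2 ^ m) (\<lambda>\<omega> x. low_bits m (h \<omega> x)))"

section \<open>The fixed-size Count-Min sketch with one array\<close>

definition add_at :: "nat \<Rightarrow> int \<Rightarrow> int list \<Rightarrow> int list" where
  "add_at j d A = A[j := A ! j + d]"

definition cms_run :: "nat \<Rightarrow> ('k \<Rightarrow> nat) \<Rightarrow> 'k stream \<Rightarrow> int list" where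
  "cms_run w g s = fold (\<lambda>(x, d). add_at (g x) d) s (replicate w 0)"

definition cms_error :: "nat \<Rightarrow> ('k \<Rightarrow> nat) \<Rightarrow> 'k stream \<Rightarrow> 'k \<Rightarrow> int" where
  "cms_error w g s x = cms_run w g s ! g x - freq s x"

text \<open>The error term of the fixed-size sketch for key count \<open>N\<close>: its largest expected error,
  over all streams with current key count \<open>N\<close> and all queried keys.\<close>

definition cms_error_term :: "'w measure \<Rightarrow> nat \<Rightarrow> ('w \<Rightarrow> 'k \<Rightarrow> nat) \<Rightarrow> int \<Rightarrow> real" where
  "cms_error_term M w g N =
     (SUP (s, x)\<in>{(s, x). valid_stream s \<and> key_count s = N}.
        (\<integral>\<omega>. real_of_int (cms_error w (g \<omega>) s x) \<partial>M))"

section \<open>The expandable sketch\<close>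

text \<open>
  \<open>threshold\<close> is the key count at which the latest expansion took place (before the first
  expansion: the key count \<open>N0\<close> for which the initial array was allocated). \<open>saved\<close> holds, most
  recent first, the array and the threshold as they were before each expansion that has not
  been undone.
\<close>

record sketch =
  counters :: "int list"
  total :: int
  threshold :: int
  saved :: "(int list \<times> int) list"

definition sublime_init :: "nat \<Rightarrow> nat \<Rightarrow> sketch" where
  "sublime_init w0 N0 =
     \<lparr>counters = replicate w0 0, total = 0, threshold = int N0, saved = []\<rparr>"

definition index :: "('k \<Rightarrow> nat \<Rightarrow> bool) \<Rightarrow> sketch \<Rightarrow> 'k \<Rightarrow> nat" where
  "index h S x = low_bits (floor_log (length (counters S))) (h x)"

definition expand :: "sketch \<Rightarrow> sketch" where
  "expand S =
     S\<lparr>counters := counters S @ counters S,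
       threshold := total S,
       saved := (counters S, threshold S) # saved S\<rparr>"

text \<open>With \<open>B\<close> the recorded array and \<open>L\<close>, \<open>R\<close> the halves of the current array, the new array
  is \<open>B + (L - B) + (R - B)\<close>.\<close>

definition merge :: "int list \<Rightarrow> int list \<Rightarrow> int list" where
  "merge B A =
     map (\<lambda>j. B ! j + (A ! j - B ! j) + (A ! (j + length B) - B ! j)) [0..<length B]"

definition contract :: "sketch \<Rightarrow> sketch" where
  "contract S =
     (case saved S of
        [] \<Rightarrow> S
      | (B, t) # rest \<Rightarrow>
          S\<lparr>counters := merge B (counters S), threshold := t, saved := rest\<rparr>)"

definition must_expand :: "(real \<Rightarrow> real) \<Rightarrow> sketch \<Rightarrow> bool" where
  "must_expand W S \<longleftrightarrow> W (real_of_int (total S)) \<ge> 2 * W (real_of_int (threshold S))"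

definition must_contract :: "sketch \<Rightarrow> bool" where
  "must_contract S \<longleftrightarrow>
     (case saved S of
        [] \<Rightarrow> False
      | (B, t) # _ \<Rightarrow> real_of_int (total S) < (real_of_int (threshold S) + real_of_int t) / 2)"

text \<open>The key count is adjusted first, then the array is resized, then the counter is updated.
  So the insertion that makes \<open>W(N)\<close> double already uses the expanded array. For a
  contraction the order is immaterial, because \<open>merge\<close> is additive.\<close>

definition sublime_step ::
  "(real \<Rightarrow> real) \<Rightarrow> ('k \<Rightarrow> nat \<Rightarrow> bool) \<Rightarrow> 'k \<times> int \<Rightarrow> sketch \<Rightarrow> sketch" where
  "sublime_step W h = (\<lambda>(x, d) S.
     let S1 = S\<lparr>total := total S + d\<rparr>;
         S2 = (if d > 0 then (if must_expand W S1 then expand S1 else S1)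
               else (if must_contract S1 then contract S1 else S1))
     in S2\<lparr>counters := add_at (index h S2 x) d (counters S2)\<rparr>)"

definition sublime_run ::
  "(real \<Rightarrow> real) \<Rightarrow> nat \<Rightarrow> nat \<Rightarrow> ('k \<Rightarrow> nat \<Rightarrow> bool) \<Rightarrow> 'k stream \<Rightarrow> sketch" where
  "sublime_run W w0 N0 h s = fold (sublime_step W h) s (sublime_init w0 N0)"

definition sublime_error ::
  "(real \<Rightarrow> real) \<Rightarrow> nat \<Rightarrow> nat \<Rightarrow> ('k \<Rightarrow> nat \<Rightarrow> bool) \<Rightarrow> 'k stream \<Rightarrow> 'k \<Rightarrow> int" where
  "sublime_error W w0 N0 h s x =
     (let S = sublime_run W w0 N0 h s in counters S ! index h S x - freq s x)"

definition sublime_expected_error ::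
  "(real \<Rightarrow> real) \<Rightarrow> nat \<Rightarrow> nat \<Rightarrow> 'w measure \<Rightarrow> ('w \<Rightarrow> 'k \<Rightarrow> nat \<Rightarrow> bool) \<Rightarrow> 'k stream \<Rightarrow> 'k \<Rightarrow> real" where
  "sublime_expected_error W w0 N0 M h s x =
     (\<integral>\<omega>. real_of_int (sublime_error W w0 N0 (h \<omega>) s x) \<partial>M)"

text \<open>The initial array has a power of two of counters, at least as many as are desired for the
  initial reference count \<open>N0\<close>; the inequality allows for rounding \<open>W(N0)\<close> up to a power of two.\<close>

definition initial_size :: "(real \<Rightarrow> real) \<Rightarrow> nat \<Rightarrow> nat \<Rightarrow> bool" where
  "initial_size W w0 N0 \<longleftrightarrow> (\<exists>k. w0 = 2 ^ k) \<and> 1 \<le> N0 \<and> W (real N0) \<le> real w0"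

definition W_sublinear :: "real \<Rightarrow> real \<Rightarrow> real \<Rightarrow> real" where
  "W_sublinear \<alpha> \<epsilon> N = N powr \<alpha> / \<epsilon>"

definition W_linear :: "real \<Rightarrow> real \<Rightarrow> real" where
  "W_linear \<epsilon> N = N / \<epsilon>"

text \<open>The number of counters of a sketch allocated upfront for \<open>N\<close> keys.\<close>

definition upfront_size :: "(real \<Rightarrow> real) \<Rightarrow> int \<Rightarrow> nat" where
  "upfront_size W N = nat \<lceil>W (real_of_int N)\<rceil>"

end

(* The sizes and thresholds of the sketch depend only on the stream, and a contraction makes the
   array look as if the undone expansion had never happened. So the error is governed by the
   stack of expansions not yet undone: if c_k is the stream before the expansion from w_k to
   w_(k+1) = 2 w_k counters and n counts the keys different from x, summation by parts gives
     E[error] = n(s) / w_i + sum_(k<i) n(c_k) / (2 w_k).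
   The expansion thresholds bound n(c_k): every summand is at most epsilon in the linear case,
   and there are about log N of them; in the sublinear case the sum is geometric with ratio
   2^(1/alpha) / 2 > 1, hence dominated by its last term. The contraction rule keeps N within
   a constant factor of the last threshold. *)

theory Submission
  imports Defs
begin

section \<open>Counts in a stream\<close>

text \<open>The obstacle is that a counter depends on the whole history of array sizes, and
  contractions rewrite that history. An update made with few counters is copied by every later
  expansion, so it keeps its coarse residue class. Summed by recorded prefixes rather than by
  updates, a counter becomes a closed formula in the prefixes \<open>c\<close>, and adding the two
  halves and subtracting the recorded array cancels the terms of the youngest \<open>c\<close>
  exactly. The formula has to be maintained for every bit string, not only for \<open>h x\<close>,
  since merging combines two different counters. The bound log_2 N times epsilon with constant 1 has
  little room. It rests on integrality (a recorded prefix has one key fewer than the threshold) and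
  on N being at least 3/4 of the last threshold once an expansion is in force. It fails for
  \<open>N0 = 1\<close>: with w0 = 1/epsilon counters and two insertions of keys other than
  \<open>x\<close>, the expected error is 3/2 epsilon, while log_2 2 = 1. That start is covered by
  the version with a constant factor.\<close>

definition hits :: "('k \<Rightarrow> 'b) \<Rightarrow> 'b \<Rightarrow> 'k stream \<Rightarrow> int" where
  "hits g v s = (\<Sum>(y, d)\<leftarrow>s. if g y = v then d else 0)"

text \<open>Unlike \<open>key_count\<close>, which sums over the set of keys seen, this form is
  additive under append, which suits induction over the stream;
  \<open>key_count_eq_net_count\<close> identifies the two.\<close>

definition net_count :: "'k stream \<Rightarrow> int" where
  "net_count s = (\<Sum>(y, d)\<leftarrow>s. d)"

definition others :: "'k \<Rightarrow> 'k stream \<Rightarrow> int" where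
  "others x s = net_count s - freq s x"

lemma hits_simps [simp]:
  "hits g v [] = 0"
  "hits g v ((y, d) # s) = (if g y = v then d else 0) + hits g v s"
  "hits g v (s @ s') = hits g v s + hits g v s'"
  by (simp_all add: hits_def)

lemma net_count_simps [simp]:
  "net_count [] = 0"
  "net_count ((y, d) # s) = d + net_count s"
  "net_count (s @ s') = net_count s + net_count s'"
  by (simp_all add: net_count_def)

lemma freq_simps [simp]:
  "freq [] x = 0"
  "freq ((y, d) # s) x = (if y = x then d else 0) + freq s x"
  "freq (s @ s') x = freq s x + freq s' x"
  by (simp_all add: freq_def)

lemma sum_freq_eq_net_count:
  assumes "finite A" "fst ` set s \<subseteq> A"
  shows "(\<Sum>x\<in>A. freq s x) = net_count s"
  using assms(2)
proof (induction s)
  case (Cons u s)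
  then show ?case
    using assms(1) by (cases u) (simp add: sum.distrib sum.delta)
qed simp

lemma key_count_eq_net_count: "key_count s = net_count s"
  unfolding key_count_def by (rule sum_freq_eq_net_count) auto

lemma valid_stream_appendD: "valid_stream (s @ s') \<Longrightarrow> valid_stream s"
proof -
  assume v: "valid_stream (s @ s')"
  have "0 \<le> freq (take n s) x" if "n \<le> length s" for n x
  proof -
    have "0 \<le> freq (take n (s @ s')) x"
      using v that unfolding valid_stream_def by (metis length_append trans_le_add1)
    then show ?thesis using that by simp
  qed
  then show ?thesis using v by (auto simp: valid_stream_def)
qed

lemma valid_stream_freq_nonneg: "valid_stream s \<Longrightarrow> 0 \<le> freq s x"
  unfolding valid_stream_def by (metis order_refl take_all)

lemma others_nonneg: "valid_stream s \<Longrightarrow> 0 \<le> others x s"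
proof -
  assume v: "valid_stream s"
  \<comment> \<open>The queried key need not occur in the stream, so the key set is enlarged by
    \<open>x\<close> before \<open>x\<close> is split off.\<close>
  have "net_count s = (\<Sum>y\<in>insert x (fst ` set s). freq s y)"
    by (rule sum_freq_eq_net_count [symmetric]) auto
  also have "\<dots> = freq s x + (\<Sum>y\<in>fst ` set s - {x}. freq s y)"
    by (subst sum.insert_remove) auto
  finally have "others x s = (\<Sum>y\<in>fst ` set s - {x}. freq s y)"
    by (simp add: others_def)
  then show ?thesis
    using v by (simp add: sum_nonneg valid_stream_freq_nonneg)
qed

lemma others_le: "valid_stream s \<Longrightarrow> others x s \<le> net_count s"
  using valid_stream_freq_nonneg [of s x] by (simp add: others_def)

lemma net_count_nonneg: "valid_stream s \<Longrightarrow> 0 \<le> net_count s"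
  using others_nonneg [of s undefined] others_le [of s undefined] by simp

lemma others_eq_0:
  assumes "\<And>y. y = x"
  shows "others x s = 0"
proof (induction s)
  case (Cons u s)
  then show ?case using assms by (cases u) (auto simp: others_def)
qed (simp add: others_def)

section \<open>Collisions of a pairwise independent hash function\<close>

text \<open>Split the event by the common value: by independence each of the \<open>w\<close> values
  contributes 1/w^2.\<close>

lemma pairwise_hash_collision:
  assumes "pairwise_hash M w g" "x \<noteq> y"
  shows "measure M {\<omega> \<in> space M. g \<omega> x = g \<omega> y} = 1 / real w"
proof -
  interpret prob_space M using assms(1) by (simp add: pairwise_hash_def)
  have meas: "(\<lambda>\<omega>. g \<omega> z) \<in> measurable M (count_space UNIV)" for z
    using assms(1) by (simp add: pairwise_hash_def)
  have lt: "g \<omega> z < w" if "\<omega> \<in> space M" for \<omega> z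
    using assms(1) that by (simp add: pairwise_hash_def)
  obtain \<omega>0 where "\<omega>0 \<in> space M" using not_empty by blast
  then have w: "w > 0" using lt [of \<omega>0 x] by simp
  have unif: "prob ((\<lambda>\<omega>. g \<omega> z) -` {v} \<inter> space M) = 1 / real w" if "v < w" for z v
  proof -
    have "(\<lambda>\<omega>. g \<omega> z) -` {v} \<inter> space M = {\<omega> \<in> space M. g \<omega> z = v}" by auto
    then show ?thesis using assms(1) that by (simp add: pairwise_hash_def)
  qed
  have indep: "indep_var (count_space UNIV) (\<lambda>\<omega>. g \<omega> x) (count_space UNIV) (\<lambda>\<omega>. g \<omega> y)"
    using assms by (simp add: pairwise_hash_def)
  define E where "E v = ((\<lambda>\<omega>. g \<omega> x) -` {v} \<inter> space M) \<inter> ((\<lambda>\<omega>. g \<omega> y) -` {v} \<inter> space M)" for v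
  have "prob (E v) = 1 / real w * (1 / real w)" if "v < w" for v
  proof -
    have "E v = (\<lambda>\<omega>. (g \<omega> x, g \<omega> y)) -` ({v} \<times> {v}) \<inter> space M"
      by (auto simp: E_def)
    then show ?thesis
      using indep_varD [OF indep, of "{v}" "{v}"] unif [OF that] by simp
  qed
  moreover have "{\<omega> \<in> space M. g \<omega> x = g \<omega> y} = (\<Union>v\<in>{..<w}. E v)"
    using lt by (auto simp: E_def)
  moreover have "prob (\<Union>v\<in>{..<w}. E v) = (\<Sum>v<w. prob (E v))"
  proof (rule finite_measure_finite_Union)
    show "E ` {..<w} \<subseteq> sets M"
      unfolding E_def using meas by (auto intro!: sets.Int measurable_sets)
    show "disjoint_family_on E {..<w}"
      by (auto simp: disjoint_family_on_def E_def)
  qed simp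
  ultimately show ?thesis using w by simp
qed

lemma has_bochner_integral_collision:
  assumes "pairwise_hash M w g"
  shows "has_bochner_integral M (\<lambda>\<omega>. of_bool (g \<omega> y = g \<omega> x))
    (if y = x then 1 else 1 / real w)"
proof (cases "y = x")
  case True
  interpret prob_space M using assms(1) by (simp add: pairwise_hash_def)
  show ?thesis
    using True by (simp add: has_bochner_integral_iff prob_space)
next
  case False
  interpret prob_space M using assms(1) by (simp add: pairwise_hash_def)
  have [measurable]: "(\<lambda>\<omega>. real (g \<omega> z)) \<in> borel_measurable M" for z
    using assms(1) by (auto simp: pairwise_hash_def intro: measurable_compose)
  let ?A = "{\<omega> \<in> space M. g \<omega> y = g \<omega> x}"
  have "?A = {\<omega> \<in> space M. real (g \<omega> y) = real (g \<omega> x)}" by simp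
  also have "\<dots> \<in> sets M" by measurable
  finally have [measurable]: "?A \<in> sets M" .
  have "has_bochner_integral M (indicator ?A) (measure M ?A)"
    by (rule has_bochner_integral_real_indicator) (auto simp: emeasure_eq_measure)
  then show ?thesis
    unfolding pairwise_hash_collision [OF assms False]
    by (subst has_bochner_integral_cong [where g = "indicator ?A"]) (auto simp: False indicator_def)
qed

text \<open>Linearity is applied update by update, so that deletions are just negative summands;
  updates of \<open>x\<close> itself collide surely, all others with probability 1/w.\<close>

lemma has_bochner_integral_hits:
  assumes "pairwise_hash M w g"
  shows "has_bochner_integral M (\<lambda>\<omega>. real_of_int (hits (g \<omega>) (g \<omega> x) s))
    (real_of_int (freq s x) + real_of_int (others x s) / real w)"
proof (induction s)
  case Nil
  then show ?case by (simp add: others_def has_bochner_integral_zero)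
next
  case (Cons u s)
  obtain y d where u: "u = (y, d)" by (cases u)
  have "has_bochner_integral M
      (\<lambda>\<omega>. real_of_int d * of_bool (g \<omega> y = g \<omega> x) + real_of_int (hits (g \<omega>) (g \<omega> x) s))
      (real_of_int d * (if y = x then 1 else 1 / real w) +
        (real_of_int (freq s x) + real_of_int (others x s) / real w))"
    by (intro has_bochner_integral_add Cons has_bochner_integral_mult_right
        has_bochner_integral_collision [OF assms])
  moreover have "real_of_int d * of_bool (g \<omega> y = g \<omega> x) + real_of_int (hits (g \<omega>) (g \<omega> x) s)
      = real_of_int (hits (g \<omega>) (g \<omega> x) (u # s))" for \<omega>
    by (simp add: u)
  moreover have "real_of_int d * (if y = x then 1 else 1 / real w) +
        (real_of_int (freq s x) + real_of_int (others x s) / real w)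
      = real_of_int (freq (u # s) x) + real_of_int (others x (u # s)) / real w"
    by (simp add: u others_def add_divide_distrib diff_divide_distrib)
  ultimately show ?case by simp
qed

section \<open>The error term of the fixed-size sketch\<close>

lemma length_cms_run [simp]: "length (cms_run w g s) = w"
  unfolding cms_run_def
  by (induction s rule: rev_induct) (auto simp: add_at_def split: prod.splits)

lemma cms_run_nth:
  assumes "v < w"
  shows "cms_run w g s ! v = hits g v s"
proof (induction s rule: rev_induct)
  case Nil
  then show ?case using assms by (simp add: cms_run_def)
next
  case (snoc u s)
  obtain y d where u: "u = (y, d)" by (cases u)
  have "cms_run w g (s @ [u]) = add_at (g y) d (cms_run w g s)"
    by (simp add: cms_run_def u)
  then show ?case
    using snoc assms by (auto simp: add_at_def u nth_list_update)
qed

lemma cms_expected_error: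
  assumes "pairwise_hash M w g"
  shows "(\<integral>\<omega>. real_of_int (cms_error w (g \<omega>) s x) \<partial>M) = real_of_int (others x s) / real w"
proof -
  interpret prob_space M using assms(1) by (simp add: pairwise_hash_def)
  have "(\<integral>\<omega>. real_of_int (cms_error w (g \<omega>) s x) \<partial>M)
      = (\<integral>\<omega>. real_of_int (hits (g \<omega>) (g \<omega> x) s) - real_of_int (freq s x) \<partial>M)"
  proof (rule Bochner_Integration.integral_cong)
    fix \<omega> assume "\<omega> \<in> space M"
    then have "g \<omega> x < w" using assms by (simp add: pairwise_hash_def)
    then show "real_of_int (cms_error w (g \<omega>) s x)
      = real_of_int (hits (g \<omega>) (g \<omega> x) s) - real_of_int (freq s x)"
      by (simp add: cms_error_def cms_run_nth)
  qed simp
  also have "\<dots> = real_of_int (others x s) / real w"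
    using has_bochner_integral_hits [OF assms, of x s]
    by (simp add: has_bochner_integral_iff prob_space)
  finally show ?thesis .
qed

lemma cms_error_term_ge:
  fixes g :: "'w \<Rightarrow> 'k \<Rightarrow> nat" and x :: 'k and s :: "'k stream"
  assumes "pairwise_hash M w g" "valid_stream s" "net_count s = N"
  shows "real_of_int (others x s) / real w \<le> cms_error_term M w g N"
proof -
  let ?S = "{(s :: 'k stream, x :: 'k). valid_stream s \<and> key_count s = N}"
  let ?f = "\<lambda>(s, x). \<integral>\<omega>. real_of_int (cms_error w (g \<omega>) s x) \<partial>M"
  \<comment> \<open>A supremum of reals dominates its members only for bounded sets; N/w is a bound
    because at most N keys differ from \<open>x\<close>.\<close>
  have "bdd_above (?f ` ?S)"
  proof (rule bdd_aboveI2)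
    fix p assume "p \<in> ?S"
    then show "?f p \<le> real_of_int N / real w"
      using others_le
      by (auto simp: cms_expected_error [OF assms(1)] key_count_eq_net_count
          intro!: divide_right_mono)
  qed
  moreover have "(s, x) \<in> ?S" using assms by (simp add: key_count_eq_net_count)
  ultimately have "?f (s, x) \<le> (SUP p\<in>?S. ?f p)"
    by (rule cSUP_upper2) simp
  then show ?thesis
    by (simp add: cms_error_term_def cms_expected_error [OF assms(1)])
qed

lemma cms_error_term_nonneg:
  fixes g :: "'w \<Rightarrow> 'k \<Rightarrow> nat" and s :: "'k stream"
  assumes "pairwise_hash M w g" "valid_stream s" "net_count s = N"
  shows "0 \<le> cms_error_term M w g N"
proof -
  have "0 \<le> real_of_int (others undefined s) / real w"
    using others_nonneg [OF assms(2)] by simp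
  also have "\<dots> \<le> cms_error_term M w g N"
    by (rule cms_error_term_ge [OF assms])
  finally show ?thesis .
qed

text \<open>The worst stream for the fixed-size sketch inserts one key \<open>y\<close> other than
  \<open>x\<close> N times.\<close>

lemma cms_error_term_ge_ratio:
  fixes x y :: 'k
  assumes "pairwise_hash M w (g :: 'w \<Rightarrow> 'k \<Rightarrow> nat)" "y \<noteq> x" "0 \<le> N"
  shows "real_of_int N / real w \<le> cms_error_term M w g N"
proof -
  let ?s = "replicate (nat N) (y, 1 :: int)"
  have rep: "freq (replicate n (y, 1)) z = (if z = y then int n else 0)"
    "net_count (replicate n (y, 1)) = int n" for n and z :: 'k
    by (induction n) auto
  have "valid_stream ?s" by (auto simp: valid_stream_def rep)
  moreover have "net_count ?s = N" "others x ?s = N"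
    using assms by (auto simp: rep others_def)
  ultimately show ?thesis using cms_error_term_ge [OF assms(1), of ?s N x] by simp
qed

section \<open>The state of the expandable sketch\<close>

lemma low_bits_Suc: "low_bits (Suc m) b = low_bits m b + of_bool (b m) * 2 ^ m"
  by (simp add: low_bits_def)

lemma low_bits_less: "low_bits m b < 2 ^ m"
  by (induction m) (auto simp: low_bits_def)

lemma low_bits_cong: "(\<And>j. j < m \<Longrightarrow> b j = b' j) \<Longrightarrow> low_bits m b = low_bits m b'"
  by (simp add: low_bits_def)

lemma low_bits_Suc_eq_iff:
  "low_bits (Suc m) b = low_bits (Suc m) b' \<longleftrightarrow> low_bits m b = low_bits m b' \<and> b m = b' m"
  using low_bits_less [of m b] low_bits_less [of m b'] by (auto simp: low_bits_Suc)

text \<open>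
  An expansion stack lists, most recent first, the stream seen before each expansion that has not
  been undone, with the threshold valid at that time. An update made with \<open>2 ^ (K + k)\<close> counters
  is counted modulo \<open>2 ^ (K + k)\<close>; collected by prefixes of the stream, this gives the following
  correction to the counter of a sketch that used the current array size throughout.
\<close>

type_synonym 'k stack = "('k stream \<times> int) list"

fun correction :: "('k \<Rightarrow> nat \<Rightarrow> bool) \<Rightarrow> nat \<Rightarrow> 'k stack \<Rightarrow> (nat \<Rightarrow> bool) \<Rightarrow> int" where
  "correction h K [] b = 0"
| "correction h K ((c, t) # stk) b = correction h K stk b
     + hits (\<lambda>y. low_bits (K + length stk) (h y)) (low_bits (K + length stk) b) c
     - hits (\<lambda>y. low_bits (Suc (K + length stk)) (h y)) (low_bits (Suc (K + length stk)) b) c"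

definition estimate ::
  "('k \<Rightarrow> nat \<Rightarrow> bool) \<Rightarrow> nat \<Rightarrow> 'k stream \<Rightarrow> 'k stack \<Rightarrow> (nat \<Rightarrow> bool) \<Rightarrow> int" where
  "estimate h K s stk b = correction h K stk b
     + hits (\<lambda>y. low_bits (K + length stk) (h y)) (low_bits (K + length stk) b) s"

text \<open>Counters are addressed by bit strings instead of indices, so that the two halves of an
  array are reached by setting a single bit of \<open>b\<close>.\<close>

definition holds_estimates ::
  "('k \<Rightarrow> nat \<Rightarrow> bool) \<Rightarrow> nat \<Rightarrow> 'k stream \<Rightarrow> 'k stack \<Rightarrow> int list \<Rightarrow> bool" where
  "holds_estimates h K s stk A \<longleftrightarrow> length A = 2 ^ (K + length stk) \<and>
     (\<forall>b. A ! low_bits (K + length stk) b = estimate h K s stk b)"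

text \<open>The recorded arrays take part in later merges, so the invariant must cover them too,
  each with respect to the prefix at which it was recorded and the rest of the stack.\<close>

fun represents :: "('k \<Rightarrow> nat \<Rightarrow> bool) \<Rightarrow> nat \<Rightarrow> 'k stream \<Rightarrow> 'k stack \<Rightarrow>
    int list \<Rightarrow> (int list \<times> int) list \<Rightarrow> bool" where
  "represents h K s [] A sv \<longleftrightarrow> sv = [] \<and> holds_estimates h K s [] A"
| "represents h K s ((c, t) # stk) A sv \<longleftrightarrow> holds_estimates h K s ((c, t) # stk) A \<and>
     (\<exists>B sv'. sv = (B, t) # sv' \<and> represents h K c stk B sv')"

section \<open>Preservation of the invariant by updates, expansions and contractions\<close>

lemma represents_holds_estimates:
  "represents h K s stk A sv \<Longrightarrow> holds_estimates h K s stk A"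
  by (cases stk) auto

lemma correction_cong:
  assumes "\<And>j. j < K + length stk \<Longrightarrow> b j = b' j"
  shows "correction h K stk b = correction h K stk b'"
  using assms
proof (induction stk)
  case (Cons p stk)
  obtain c t where p: "p = (c, t)" by (cases p)
  have "low_bits (K + length stk) b = low_bits (K + length stk) b'"
    "low_bits (Suc (K + length stk)) b = low_bits (Suc (K + length stk)) b'"
    using Cons.prems by (auto intro!: low_bits_cong)
  then show ?case using Cons by (simp add: p)
qed simp

lemma represents_replicate: "represents h K [] [] (replicate (2 ^ K) 0) []"
  by (simp add: holds_estimates_def estimate_def low_bits_less)

lemma represents_update:
  assumes "represents h K s stk A sv"
  shows "represents h K (s @ [(x, d)]) stk (add_at (low_bits (K + length stk) (h x)) d A) sv"
proof -
  let ?m = "K + length stk"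
  have A: "length A = 2 ^ ?m" "\<And>b. A ! low_bits ?m b = estimate h K s stk b"
    using represents_holds_estimates [OF assms] by (auto simp: holds_estimates_def)
  have "add_at (low_bits ?m (h x)) d A ! low_bits ?m b
      = A ! low_bits ?m b + (if low_bits ?m (h x) = low_bits ?m b then d else 0)" for b
    using low_bits_less [of ?m] by (simp add: add_at_def A(1) nth_list_update)
  then have "holds_estimates h K (s @ [(x, d)]) stk (add_at (low_bits ?m (h x)) d A)"
    by (simp add: holds_estimates_def A estimate_def) (simp add: add_at_def A(1))
  then show ?thesis using assms by (cases stk) auto
qed

text \<open>Copying changes no estimate: the new \<open>correction\<close> term is coarse hits minus
  fine hits of \<open>s\<close>, and its second half cancels against the fine hits of
  \<open>s\<close> in \<open>estimate\<close>.\<close>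

lemma represents_expand:
  assumes "represents h K s stk A sv"
  shows "represents h K s ((s, t) # stk) (A @ A) ((A, t) # sv)"
proof -
  have A: "length A = 2 ^ (K + length stk)"
    "\<And>b. A ! low_bits (K + length stk) b = estimate h K s stk b"
    using represents_holds_estimates [OF assms] by (auto simp: holds_estimates_def)
  have "(A @ A) ! low_bits (Suc (K + length stk)) b = A ! low_bits (K + length stk) b" for b
    using low_bits_less [of "K + length stk" b] by (simp add: low_bits_Suc nth_append A(1))
  then have "holds_estimates h K s ((s, t) # stk) (A @ A)"
    using A by (simp add: holds_estimates_def estimate_def)
  then show ?thesis using assms by simp
qed

text \<open>A residue class modulo 2^m is the disjoint union of two classes modulo 2^(m+1), told
  apart by bit \<open>m\<close>.\<close>

lemma hits_low_bits_split:
  "hits (\<lambda>y. low_bits (Suc m) (h y)) (low_bits (Suc m) (b(m := False))) s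
   + hits (\<lambda>y. low_bits (Suc m) (h y)) (low_bits (Suc m) (b(m := True))) s
   = hits (\<lambda>y. low_bits m (h y)) (low_bits m b) s"
proof -
  have "low_bits m (b(m := v)) = low_bits m b" for v
    by (rule low_bits_cong) simp
  then show ?thesis
    by (induction s) (auto simp: low_bits_Suc_eq_iff)
qed

text \<open>Let C be the correction of \<open>stk\<close>, and H(c), H(s) the coarse hits. The two
  halves add up to 2C + 2H(c) - H(c) + H(s), because their fine hits combine to coarse ones.
  Subtracting the recorded C + H(c) leaves C + H(s), with no trace of \<open>c\<close>.\<close>

lemma represents_contract:
  assumes "represents h K s ((c, t) # stk) A ((B, t') # sv)"
  shows "represents h K s stk (merge B A) sv"
proof -
  let ?m = "K + length stk"
  have B: "represents h K c stk B sv" using assms by auto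
  have lenB: "length B = 2 ^ ?m"
    and Bn: "\<And>b. B ! low_bits ?m b = estimate h K c stk b"
    using represents_holds_estimates [OF B] by (auto simp: holds_estimates_def)
  have An: "\<And>b. A ! low_bits (Suc ?m) b = estimate h K s ((c, t) # stk) b"
    using represents_holds_estimates [OF assms] by (auto simp: holds_estimates_def)
  have "merge B A ! low_bits ?m b = estimate h K s stk b" for b
  proof -
    \<comment> \<open>The two bit strings that extend the index of the merged counter address its
      sources in the left and the right half.\<close>
    define b0 where "b0 = b(?m := False)"
    define b1 where "b1 = b(?m := True)"
    have lb: "low_bits ?m b0 = low_bits ?m b" "low_bits ?m b1 = low_bits ?m b"
      by (auto simp: b0_def b1_def intro!: low_bits_cong)
    have co: "correction h K stk b0 = correction h K stk b"
      "correction h K stk b1 = correction h K stk b"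
      by (auto simp: b0_def b1_def intro!: correction_cong)
    have "merge B A ! low_bits ?m b = A ! low_bits (Suc ?m) b0 + A ! low_bits (Suc ?m) b1
        - B ! low_bits ?m b"
      using lb low_bits_less [of ?m b]
      by (simp add: merge_def lenB low_bits_Suc b0_def b1_def)
    also have "\<dots> = estimate h K s stk b"
      unfolding An Bn
      using hits_low_bits_split [of ?m h b s] hits_low_bits_split [of ?m h b c]
      by (simp add: estimate_def lb co flip: b0_def b1_def)
    finally show ?thesis .
  qed
  then have "holds_estimates h K s stk (merge B A)"
    by (simp add: holds_estimates_def merge_def lenB)
  then show ?thesis using B by (cases stk) auto
qed

section \<open>Thresholds\<close>

text \<open>\<open>W_doubling\<close> says that doubling \<open>W\<close> takes at least a doubling
  of the key count, so thresholds at least double. With \<open>b = a\<close> it also yields that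
  \<open>W a\<close> is positive for \<open>a\<close> at least 1.\<close>

locale size_function =
  fixes W :: "real \<Rightarrow> real"
  assumes W_mono: "0 \<le> a \<Longrightarrow> a \<le> b \<Longrightarrow> W a \<le> W b"
    and W_doubling: "1 \<le> a \<Longrightarrow> 0 \<le> b \<Longrightarrow> 2 * W a \<le> W b \<Longrightarrow> 2 * a \<le> b"
begin

text \<open>The deterministic half of the invariant: neither an expansion nor a contraction is due
  now, and the same held for every recorded prefix at its time. The \<open>+ 1\<close> is there
  because a prefix is recorded just before the insertion that triggers the expansion.\<close>

fun admissible :: "nat \<Rightarrow> 'k stream \<Rightarrow> int \<Rightarrow> 'k stack \<Rightarrow> bool" where
  "admissible N0 s thr [] \<longleftrightarrow> valid_stream s \<and> thr = int N0 \<and>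
     W (real_of_int (net_count s)) < 2 * W (real_of_int thr)"
| "admissible N0 s thr ((c, t) # stk) \<longleftrightarrow> valid_stream s \<and> thr = net_count c + 1 \<and>
     W (real_of_int (net_count s)) < 2 * W (real_of_int thr) \<and>
     2 * W (real_of_int t) \<le> W (real_of_int thr) \<and> thr + t \<le> 2 * net_count s \<and>
     admissible N0 c t stk"

lemma admissible_valid: "admissible N0 s thr stk \<Longrightarrow> valid_stream s"
  by (cases stk) auto

lemma admissible_less: "admissible N0 s thr stk \<Longrightarrow>
    W (real_of_int (net_count s)) < 2 * W (real_of_int thr)"
  by (cases stk) auto

lemma admissible_ConsD:
  assumes "admissible N0 s thr ((c, t) # stk)"
  shows "valid_stream c" and "admissible N0 c t stk" and "thr = net_count c + 1"
    and "2 * W (real_of_int t) \<le> W (real_of_int thr)" and "thr + t \<le> 2 * net_count s"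
  using assms admissible_valid by auto

lemma admissible_threshold_pos: "admissible N0 s thr stk \<Longrightarrow> 1 \<le> N0 \<Longrightarrow> 1 \<le> thr"
  using admissible_valid net_count_nonneg by (cases stk) fastforce+

lemma admissible_threshold_double:
  assumes "admissible N0 s thr ((c, t) # stk)" "1 \<le> N0"
  shows "2 * t \<le> thr"
proof -
  have "1 \<le> t" using assms admissible_threshold_pos by auto
  moreover have "0 \<le> thr"
    using admissible_threshold_pos [OF assms] by simp
  ultimately have "2 * real_of_int t \<le> real_of_int thr"
    by - (rule W_doubling, use assms in auto)
  then show ?thesis by linarith
qed

text \<open>The stack is quantified before \<open>h\<close>: one stack serves all outcomes, so
  expectations can be taken with the stack fixed.\<close>

lemma sublime_run_represents:
  assumes "valid_stream s" "1 \<le> N0"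
  shows "\<exists>thr stk. admissible N0 s thr stk \<and>
    (\<forall>h. let S = sublime_run W (2 ^ K) N0 h s in total S = net_count s \<and> threshold S = thr \<and>
       represents h K s stk (counters S) (saved S))"
  using assms(1)
proof (induction s rule: rev_induct)
  case Nil
  \<comment> \<open>Otherwise \<open>W_doubling\<close> would give 2 N0 <= 0.\<close>
  have "W 0 < 2 * W (real N0)"
    using W_doubling [of "real N0" 0] assms(2) by fastforce
  then have "admissible N0 [] (int N0) []"
    by (simp add: valid_stream_def)
  then show ?case
    using represents_replicate by (fastforce simp: sublime_run_def sublime_init_def)
next
  case (snoc u s)
  obtain x d where u: "u = (x, d)" by (cases u)
  define s' where "s' = s @ [u]"
  have valid': "valid_stream s'" using snoc.prems by (simp add: s'_def)
  define R where "R h = sublime_run W (2 ^ K) N0 h s" for h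
  define R' where "R' h = sublime_run W (2 ^ K) N0 h s'" for h
  obtain thr stk where adm: "admissible N0 s thr stk" and
    rep: "\<And>h. total (R h) = net_count s" "\<And>h. threshold (R h) = thr"
      "\<And>h. represents h K s stk (counters (R h)) (saved (R h))"
    using snoc.IH [OF valid_stream_appendD [OF snoc.prems]] by (auto simp: Let_def R_def)
  define update where
    "update h S = S\<lparr>counters := add_at (index h S x) d (counters S)\<rparr>" for h and S :: sketch
  have n': "net_count s' = net_count s + d" by (simp add: s'_def u)
  have run: "R' h = (let S1 = R h\<lparr>total := net_count s'\<rparr> in update h
      (if d > 0 then (if must_expand W S1 then expand S1 else S1)
       else (if must_contract S1 then contract S1 else S1)))" for h
  proof -
    have "R' h = sublime_step W h (x, d) (R h)"
      by (simp add: R'_def R_def sublime_run_def s'_def u)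
    then show ?thesis by (simp add: sublime_step_def update_def n' rep(1) Let_def)
  qed
  have pos: "0 \<le> net_count s" "0 \<le> net_count s'" "1 \<le> thr"
    using net_count_nonneg valid' admissible_valid [OF adm]
      admissible_threshold_pos [OF adm assms(2)] by auto
  have d: "d = 1 \<or> d = -1"
    using snoc.prems by (auto simp: valid_stream_def u)
  have len: "length A = 2 ^ (K + length stk')"
    if "represents h K r stk' A sv" for h r A sv and stk' :: "'a stack"
    using represents_holds_estimates [OF that] by (simp add: holds_estimates_def)
  have upd: "represents h K s' stk' (add_at (low_bits (floor_log (length A)) (h x)) d A) sv"
    if "represents h K s stk' A sv" for h A sv and stk' :: "'a stack"
    using represents_update [OF that, of x d] len [OF that] by (simp add: s'_def u)
  have unchanged: "total (R' h) = net_count s' \<and> threshold (R' h) = thr \<and>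
        represents h K s' stk (counters (R' h)) (saved (R' h))"
    if "\<And>h. R' h = update h (R h\<lparr>total := net_count s'\<rparr>)" for h
    using upd [OF rep(3)] by (simp add: that update_def index_def rep)
  \<comment> \<open>Only \<open>grow\<close> and \<open>shrink\<close> alter the stack; the other
    three cases extend the stream and keep the stack.\<close>
  consider (grow) "d = 1" "2 * W (real_of_int thr) \<le> W (real_of_int (net_count s'))"
    | (keep) "d = 1" "W (real_of_int (net_count s')) < 2 * W (real_of_int thr)"
    | (bottom) "d = -1" "stk = []"
    | (above) c t rest where "d = -1" "stk = (c, t) # rest" "thr + t \<le> 2 * net_count s'"
    | (shrink) c t rest where "d = -1" "stk = (c, t) # rest" "2 * net_count s' < thr + t"
  proof (cases "d = 1")
    case True
    then show ?thesis
      using that(1,2) by (cases "2 * W (real_of_int thr) \<le> W (real_of_int (net_count s'))") auto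
  next
    case False
    then have "d = -1" using d by simp
    show ?thesis
    proof (cases stk)
      case Nil
      then show ?thesis using that(3) \<open>d = -1\<close> by simp
    next
      case (Cons p rest)
      then show ?thesis using that(4,5) \<open>d = -1\<close>
        by (cases p, cases "thr + snd p \<le> 2 * net_count s'") auto
    qed
  qed
  then have "\<exists>thr stk. admissible N0 s' thr stk \<and>
    (\<forall>h. total (R' h) = net_count s' \<and> threshold (R' h) = thr \<and>
       represents h K s' stk (counters (R' h)) (saved (R' h)))"
  proof cases
    case grow
    have thr': "2 * real_of_int thr \<le> real_of_int (net_count s')"
      by (rule W_doubling) (use grow pos in auto)
    have "W (real_of_int (net_count s')) < 2 * W (real_of_int (net_count s'))"
      using W_doubling [of "real_of_int (net_count s')" "real_of_int (net_count s')"] pos thr'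
      by fastforce
    then have "admissible N0 s' (net_count s') ((s, thr) # stk)"
      using adm grow valid' thr' pos by (simp add: n')
    moreover have "total (R' h) = net_count s' \<and> threshold (R' h) = net_count s' \<and>
        represents h K s' ((s, thr) # stk) (counters (R' h)) (saved (R' h))" for h
    proof -
      have "must_expand W (R h\<lparr>total := net_count s'\<rparr>)"
        using grow by (simp add: must_expand_def rep)
      then have "R' h = update h (expand (R h\<lparr>total := net_count s'\<rparr>))"
        using grow by (simp add: run Let_def)
      then show ?thesis
        using upd [OF represents_expand [OF rep(3)]] by (simp add: update_def expand_def index_def rep)
    qed
    ultimately show ?thesis by blast
  next
    case keep
    have "admissible N0 s' thr stk"
      using adm keep valid' by (cases stk) (auto simp: n')
    moreover have "\<not> must_expand W (R h\<lparr>total := net_count s'\<rparr>)" for h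
      using keep by (simp add: must_expand_def rep)
    then have "R' h = update h (R h\<lparr>total := net_count s'\<rparr>)" for h
      using keep by (simp add: run Let_def)
    note unchanged [OF this]
    ultimately show ?thesis by blast
  next
    case bottom
    have "W (real_of_int (net_count s')) \<le> W (real_of_int (net_count s))"
      using bottom pos by (intro W_mono) (auto simp: n')
    then have "admissible N0 s' thr stk"
      using adm bottom valid' by auto
    moreover have "saved (R h) = []" for h
      using rep(3) [of h] bottom by simp
    then have "R' h = update h (R h\<lparr>total := net_count s'\<rparr>)" for h
      using bottom by (simp add: run must_contract_def Let_def)
    note unchanged [OF this]
    ultimately show ?thesis by blast
  next
    case above
    have "W (real_of_int (net_count s')) \<le> W (real_of_int (net_count s))"
      using above pos by (intro W_mono) (auto simp: n')
    then have "admissible N0 s' thr stk"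
      using adm above valid' by auto
    moreover have "\<not> must_contract (R h\<lparr>total := net_count s'\<rparr>)" for h
    proof -
      have "real_of_int (thr + t) \<le> real_of_int (2 * net_count s')"
        using above(3) by (simp only: of_int_le_iff)
      then show ?thesis
        using rep(3) [of h] above by (auto simp: must_contract_def rep)
    qed
    then have "R' h = update h (R h\<lparr>total := net_count s'\<rparr>)" for h
      using above by (simp add: run Let_def)
    note unchanged [OF this]
    ultimately show ?thesis by blast
  next
    case shrink
    have admc: "admissible N0 c t rest" and thr: "thr = net_count c + 1"
      and prev: "thr + t \<le> 2 * net_count s"
      using adm shrink by auto
    have tpos: "1 \<le> t" by (rule admissible_threshold_pos [OF admc assms(2)])
    have tthr: "2 * t \<le> thr"
      using admissible_threshold_double adm shrink assms(2) by blast
    \<comment> \<open>Falling below the average of \<open>thr\<close> and \<open>t\<close>, with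
      \<open>2 * t\<close> at most \<open>thr\<close>, brings the count back to that of
      \<open>c\<close> or lower, so the bound that held for \<open>c\<close> shows that no expansion
      is due with respect to \<open>t\<close>.\<close>
    have "net_count s' \<le> net_count c"
      using shrink tthr tpos thr by linarith
    then have "W (real_of_int (net_count s')) \<le> W (real_of_int (net_count c))"
      using pos by (intro W_mono) auto
    then have less: "W (real_of_int (net_count s')) < 2 * W (real_of_int t)"
      using admissible_less [OF admc] by simp
    have "admissible N0 s' t rest"
    proof (cases rest)
      case Nil
      then show ?thesis using admc less valid' by simp
    next
      case (Cons p rest')
      obtain c' t' where p: "p = (c', t')" by (cases p)
      have adm': "admissible N0 c t ((c', t') # rest')"
        using admc unfolding Cons p .
      then have "2 * t' \<le> t" "1 \<le> t'"
        using admissible_threshold_double [OF adm' assms(2)]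
          admissible_threshold_pos [of N0 c' t' rest'] assms(2) by auto
      \<comment> \<open>One deletion never calls for two contractions: it lowers 2N by 2 only, and
        2N' >= thr + t - 2 >= 3t - 2 >= t + t' by the doubling of thresholds.\<close>
      then have "t + t' \<le> 2 * net_count s'"
        using prev tthr shrink n' by linarith
      then show ?thesis
        using admissible_ConsD [OF adm'] less valid' by (simp add: Cons p)
    qed
    moreover have "total (R' h) = net_count s' \<and> threshold (R' h) = t \<and>
        represents h K s' rest (counters (R' h)) (saved (R' h))" for h
    proof -
      obtain B sv where sv: "saved (R h) = (B, t) # sv"
        using rep(3) [of h] shrink by auto
      have "real_of_int (2 * net_count s') < real_of_int (thr + t)"
        using shrink(3) by (simp only: of_int_less_iff)
      then have "must_contract (R h\<lparr>total := net_count s'\<rparr>)"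
        by (simp add: must_contract_def rep sv)
      then have "R' h = update h (contract (R h\<lparr>total := net_count s'\<rparr>))"
        using shrink(1) by (simp add: run Let_def)
      moreover have "represents h K s rest (merge B (counters (R h))) sv"
        using rep(3) [of h] represents_contract unfolding sv shrink(2) by blast
      ultimately show ?thesis
        using upd by (simp add: update_def contract_def index_def sv)
    qed
    ultimately show ?thesis by blast
  qed
  then show ?case by (simp add: s'_def R'_def Let_def)
qed


end

section \<open>The expected error\<close>

fun overhead :: "nat \<Rightarrow> 'k \<Rightarrow> 'k stack \<Rightarrow> real" where
  "overhead K x [] = 0"
| "overhead K x ((c, t) # stk) =
     overhead K x stk + real_of_int (others x c) / 2 ^ Suc (K + length stk)"

definition expected_error :: "nat \<Rightarrow> 'k \<Rightarrow> 'k stream \<Rightarrow> 'k stack \<Rightarrow> real" where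
  "expected_error K x s stk =
     real_of_int (others x s) / 2 ^ (K + length stk) + overhead K x stk"

text \<open>Coarse and fine hits both count \<open>x\<close> in full, so the frequencies cancel and
  n/w - n/(2w) = n/(2w) remains for each recorded prefix.\<close>

lemma has_bochner_integral_correction:
  assumes "bitstring_hash M h"
  shows "has_bochner_integral M (\<lambda>\<omega>. real_of_int (correction (h \<omega>) K stk (h \<omega> x)))
    (overhead K x stk)"
proof (induction stk)
  case Nil
  then show ?case by (simp add: has_bochner_integral_zero)
next
  case (Cons p stk)
  obtain c t where p: "p = (c, t)" by (cases p)
  have *: "has_bochner_integral M
      (\<lambda>\<omega>. real_of_int (hits (\<lambda>y. low_bits m (h \<omega> y)) (low_bits m (h \<omega> x)) c))
      (real_of_int (freq c x) + real_of_int (others x c) / real (2 ^ m))" for m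
    using assms has_bochner_integral_hits [of M "2 ^ m" "\<lambda>\<omega> x. low_bits m (h \<omega> x)" x c]
    by (simp add: bitstring_hash_def)
  have "overhead K x (p # stk) = overhead K x stk
      + (real_of_int (freq c x) + real_of_int (others x c) / real (2 ^ (K + length stk)))
      - (real_of_int (freq c x) + real_of_int (others x c) / real (2 ^ Suc (K + length stk)))"
    by (simp add: p)
  then show ?case
    using has_bochner_integral_diff [OF has_bochner_integral_add [OF Cons * [of "K + length stk"]]
        * [of "Suc (K + length stk)"]]
    by (simp add: p)
qed

lemma integral_estimate:
  assumes "bitstring_hash M h"
  shows "(\<integral>\<omega>. real_of_int (estimate (h \<omega>) K s stk (h \<omega> x) - freq s x) \<partial>M)
    = expected_error K x s stk"
proof -
  have ph: "pairwise_hash M (2 ^ m) (\<lambda>\<omega> x. low_bits m (h \<omega> x))" for m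
    using assms by (simp add: bitstring_hash_def)
  interpret prob_space M using ph by (auto simp: pairwise_hash_def)
  have "has_bochner_integral M
    (\<lambda>\<omega>. real_of_int (correction (h \<omega>) K stk (h \<omega> x))
       + real_of_int (hits (\<lambda>y. low_bits (K + length stk) (h \<omega> y))
           (low_bits (K + length stk) (h \<omega> x)) s)
       - real_of_int (freq s x))
    (overhead K x stk
       + (real_of_int (freq s x) + real_of_int (others x s) / real (2 ^ (K + length stk)))
       - real_of_int (freq s x))"
    by (intro has_bochner_integral_diff has_bochner_integral_add
        has_bochner_integral_correction [OF assms] has_bochner_integral_hits [OF ph])
      (simp add: has_bochner_integral_iff prob_space)
  then show ?thesis
    by (simp add: estimate_def expected_error_def has_bochner_integral_iff)
qed

lemma expected_error_eq_0:
  assumes "\<And>y. y = x"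
  shows "expected_error K x s stk = 0"
proof -
  have "overhead K x stk = 0"
    by (induction stk) (auto simp: others_eq_0 [OF assms])
  then show ?thesis using others_eq_0 [OF assms] by (simp add: expected_error_def)
qed

context size_function
begin

lemma sublime_expected_error_eq:
  assumes "valid_stream s" "1 \<le> N0" "bitstring_hash M h"
  obtains thr stk where "admissible N0 s thr stk"
    "sublime_expected_error W (2 ^ K) N0 M h s x = expected_error K x s stk"
proof -
  obtain thr stk where adm: "admissible N0 s thr stk" and
    rep: "\<And>h. represents h K s stk (counters (sublime_run W (2 ^ K) N0 h s))
      (saved (sublime_run W (2 ^ K) N0 h s))"
    using sublime_run_represents [OF assms(1,2), of K] by (auto simp: Let_def)
  have "sublime_error W (2 ^ K) N0 (h \<omega>) s x = estimate (h \<omega>) K s stk (h \<omega> x) - freq s x" for \<omega>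
    using represents_holds_estimates [OF rep [of "h \<omega>"]]
    by (simp add: sublime_error_def Let_def index_def holds_estimates_def)
  then have "sublime_expected_error W (2 ^ K) N0 M h s x = expected_error K x s stk"
    by (simp only: sublime_expected_error_def integral_estimate [OF assms(3)])
  with adm that show thesis by blast
qed

text \<open>A bound for every size function: all recorded counts lie below the latest threshold, and
  the array sizes in the denominators form a geometric series.\<close>

lemma overhead_le:
  assumes "admissible N0 s thr stk" "1 \<le> N0"
  shows "overhead K x stk \<le> real_of_int thr * (1 - 1 / 2 ^ length stk) / 2 ^ K"
  using assms(1)
proof (induction stk arbitrary: s thr)
  case (Cons p stk)
  obtain c t where p: "p = (c, t)" by (cases p)
  have adm: "admissible N0 s thr ((c, t) # stk)" using Cons.prems unfolding p .
  have tt: "2 * t \<le> thr" "1 \<le> t"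
    using admissible_threshold_double [OF adm assms(2)] adm admissible_threshold_pos assms(2)
    by auto
  have "others x c \<le> thr"
    using others_le [OF admissible_ConsD(1) [OF adm], of x] admissible_ConsD(3) [OF adm] by simp
  then have "real_of_int (others x c) / 2 ^ Suc (K + length stk)
      \<le> real_of_int thr / 2 ^ Suc (K + length stk)"
    by (intro divide_right_mono) auto
  moreover have "overhead K x stk \<le> real_of_int t * (1 - 1 / 2 ^ length stk) / 2 ^ K"
    using Cons.IH [of c t] adm by simp
  moreover have "real_of_int t * (1 - 1 / 2 ^ length stk) / 2 ^ K
      \<le> real_of_int thr * (1 - 1 / 2 ^ length stk) / 2 ^ K"
    using tt by (intro divide_right_mono mult_right_mono) auto
  moreover have "real_of_int thr * (1 - 1 / 2 ^ length stk) / 2 ^ K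
      + real_of_int thr / 2 ^ Suc (K + length stk)
      = real_of_int thr * (1 - 1 / 2 ^ Suc (length stk)) / 2 ^ K"
    by (simp add: field_simps power_add)
  ultimately show ?case by (simp add: p)
qed simp

text \<open>One N comes from the current stream and 2N from the overhead, since
  \<open>thr + t\<close> is at most 2N while no contraction is due.\<close>

lemma expected_error_le_triple:
  assumes "admissible N0 s thr stk" "1 \<le> N0"
  shows "expected_error K x s stk \<le> 3 * real_of_int (net_count s)"
proof -
  have v: "valid_stream s" by (rule admissible_valid [OF assms(1)])
  have N: "0 \<le> net_count s" by (rule net_count_nonneg [OF v])
  have thr: "1 \<le> thr" by (rule admissible_threshold_pos [OF assms])
  have "real_of_int (others x s) \<le> real_of_int (net_count s) * 2 ^ (K + length stk)"
    using others_le [OF v, of x] N mult_left_mono [of 1 "2 ^ (K + length stk)" "real_of_int (net_count s)"]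
    by simp
  then have 1: "real_of_int (others x s) / 2 ^ (K + length stk) \<le> real_of_int (net_count s)"
    by (simp add: field_simps)
  have 2: "overhead K x stk \<le> 2 * real_of_int (net_count s)"
  proof (cases stk)
    case Nil
    then show ?thesis using N by simp
  next
    case (Cons p rest)
    obtain c t where p: "p = (c, t)" by (cases p)
    have "1 \<le> t" using assms admissible_threshold_pos by (auto simp: Cons p)
    then have "thr \<le> 2 * net_count s" using assms by (auto simp: Cons p)
    moreover have "real_of_int thr * ((1 - 1 / 2 ^ length stk) / 2 ^ K) \<le> real_of_int thr * 1"
    proof (rule mult_left_mono)
      have "(1 - 1 / 2 ^ length stk) / 2 ^ K \<le> (1 :: real) / 1"
        by (rule frac_le) auto
      then show "(1 - 1 / 2 ^ length stk) / 2 ^ K \<le> (1 :: real)" by simp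
    qed (use thr in simp)
    ultimately show ?thesis using overhead_le [OF assms, of K x] by simp
  qed
  from 1 2 show ?thesis by (simp add: expected_error_def)
qed

text \<open>If \<open>W(N) < 1\<close>, the upfront sketch still has one counter and its error is only \<open>N\<close>,
  which is less than \<open>N / W(N)\<close>; this case uses the bound by \<open>3 N\<close>.\<close>

lemma expected_error_le_cms:
  fixes s :: "'k stream" and g :: "'v \<Rightarrow> 'k \<Rightarrow> nat"
  assumes adm: "admissible N0 s thr stk" "1 \<le> N0"
    and le: "expected_error K x s stk \<le> B * (real_of_int N / W (real_of_int N))"
    and "2 \<le> B" and N: "N = net_count s" and pos: "0 < W (real_of_int N)"
    and hash: "pairwise_hash M (upfront_size W N) g"
  shows "expected_error K x s stk \<le> 2 * B * cms_error_term M (upfront_size W N) g N"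
proof (cases "\<forall>y. y = x")
  case True
  then show ?thesis
    using expected_error_eq_0 [of x K s stk] \<open>2 \<le> B\<close> N
      cms_error_term_nonneg [OF hash admissible_valid [OF adm(1)]] by simp
next
  case False
  then obtain y where "y \<noteq> x" by blast
  have v: "valid_stream s" by (rule admissible_valid [OF adm(1)])
  have N0: "0 \<le> N" using net_count_nonneg [OF v] N by simp
  let ?z = "W (real_of_int N)"
  let ?E = "cms_error_term M (upfront_size W N) g N"
  have E: "real_of_int N / real (upfront_size W N) \<le> ?E"
    by (rule cms_error_term_ge_ratio [OF hash \<open>y \<noteq> x\<close> N0])
  have size: "real (upfront_size W N) = of_int \<lceil>?z\<rceil>"
    using pos by (simp add: upfront_size_def)
  show ?thesis
  proof (cases "1 \<le> ?z")
    case True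
    \<comment> \<open>Rounding \<open>W(N)\<close> up to an integer costs the factor 2 in the
      conclusion.\<close>
    have "of_int \<lceil>?z\<rceil> \<le> 2 * ?z" using True by linarith
    then have "real_of_int N / (2 * ?z) \<le> real_of_int N / real (upfront_size W N)"
      unfolding size using N0 pos by (intro divide_left_mono) auto
    then have "real_of_int N / ?z \<le> 2 * ?E" using E by simp
    then have "B * (real_of_int N / ?z) \<le> B * (2 * ?E)"
      using \<open>2 \<le> B\<close> by (intro mult_left_mono) auto
    then show ?thesis using le by simp
  next
    case False
    then have "\<lceil>?z\<rceil> = 1" using pos by (simp add: ceiling_eq_iff)
    then have "real_of_int N \<le> ?E" using E size by simp
    moreover have "4 * real_of_int N \<le> 2 * B * real_of_int N"
      using \<open>2 \<le> B\<close> N0 by (intro mult_right_mono) auto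
    moreover have "2 * B * real_of_int N \<le> 2 * B * ?E"
      using calculation(1) \<open>2 \<le> B\<close> by (intro mult_left_mono) auto
    ultimately show ?thesis
      using expected_error_le_triple [OF adm, of K x] N N0 by simp
  qed
qed

end

section \<open>The linear size function\<close>

lemma size_function_linear: "0 < \<epsilon> \<Longrightarrow> size_function (W_linear \<epsilon>)"
  by unfold_locales (auto simp: W_linear_def field_simps)

text \<open>By concavity the logarithm lies above its chord on [1, 2]. Young's inequality with
  weights r - 1 and 2 - r gives the equivalent 2^(r-1) <= r.\<close>

lemma log2_ge_chord:
  fixes r :: real
  assumes "1 \<le> r" "r \<le> 2"
  shows "r - 1 \<le> log 2 r"
proof -
  have "2 powr (r - 1) * 1 powr (2 - r) \<le> (r - 1) * 2 + (2 - r) * 1"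
    using assms by (intro Youngs_inequality_0) auto
  then have "2 powr (r - 1) \<le> r" by simp
  then show ?thesis using assms by (simp add: le_log_iff)
qed

lemma log2_ge_chord_half:
  fixes r :: real
  assumes "1 / 2 \<le> r" "r \<le> 1"
  shows "2 * (r - 1) \<le> log 2 r"
proof -
  have "2 * r - 1 \<le> log 2 (2 * r)" by (rule log2_ge_chord) (use assms in auto)
  then show ?thesis using assms by (simp add: log_mult)
qed

context size_function
begin

text \<open>An insertion raises the count by one, so the count cannot jump over
  \<open>2 * t\<close>: thresholds double exactly.\<close>

lemma linear_threshold:
  assumes "W = W_linear \<epsilon>" "0 < \<epsilon>" "admissible N0 s thr stk"
  shows "thr = 2 ^ length stk * int N0"
  using assms(3)
proof (induction stk arbitrary: s thr)
  case (Cons p stk)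
  obtain c t where p: "p = (c, t)" by (cases p)
  have adm: "admissible N0 s thr ((c, t) # stk)" using Cons.prems unfolding p .
  have "real_of_int (net_count c) < 2 * real_of_int t" "2 * real_of_int t \<le> real_of_int thr"
    using admissible_less [OF admissible_ConsD(2) [OF adm]] admissible_ConsD(4) [OF adm] assms(2)
    by (simp_all add: assms(1) W_linear_def field_simps)
  then have "thr = 2 * t" using admissible_ConsD(3) [OF adm] by linarith
  then show ?case using Cons.IH [of c t] adm by (simp add: p)
qed simp

text \<open>The subtracted 1 - 1/2^i collects the savings from recorded counts being at most the
  threshold minus 1; the sharp bound for \<open>N0 = 2\<close> depends on it.\<close>

lemma linear_overhead_le:
  assumes "W = W_linear \<epsilon>" "0 < \<epsilon>" "admissible N0 s thr stk"
  shows "overhead K x stk \<le>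
    (real (length stk) * real N0 - (1 - 1 / 2 ^ length stk)) / 2 ^ K"
  using assms(3)
proof (induction stk arbitrary: s thr)
  case (Cons p stk)
  obtain c t where p: "p = (c, t)" by (cases p)
  let ?i = "length stk"
  have adm: "admissible N0 s thr ((c, t) # stk)" using Cons.prems unfolding p .
  have "others x c \<le> 2 ^ Suc ?i * int N0 - 1"
    using linear_threshold [OF assms(1,2) adm] others_le [OF admissible_ConsD(1) [OF adm], of x]
      admissible_ConsD(3) [OF adm] by simp
  then have "real_of_int (others x c) \<le> real_of_int (2 ^ Suc ?i * int N0 - 1)"
    by (simp only: of_int_le_iff)
  then have "real_of_int (others x c) / 2 ^ Suc (K + ?i)
      \<le> (2 ^ Suc ?i * real N0 - 1) / 2 ^ Suc (K + ?i)"
    by (intro divide_right_mono) auto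
  also have "\<dots> = (real N0 - 1 / 2 ^ Suc ?i) / 2 ^ K"
    by (simp add: field_simps power_add)
  finally have "overhead K x (p # stk)
      \<le> (real ?i * real N0 - (1 - 1 / 2 ^ ?i)) / 2 ^ K + (real N0 - 1 / 2 ^ Suc ?i) / 2 ^ K"
    using Cons.IH [of c t] adm by (simp add: p)
  also have "\<dots> = (real (Suc ?i) * real N0 - (1 - 1 / 2 ^ Suc ?i)) / 2 ^ K"
    by (simp add: field_simps)
  finally show ?case by simp
qed simp

text \<open>\<open>r\<close> is the key count relative to the last threshold. It is below 2 as no
  expansion is due, and at least 3/4 as no contraction is due, the previous threshold being half of
  the last.\<close>

lemma linear_expected_error_le:
  assumes lin: "W = W_linear \<epsilon>" "0 < \<epsilon>" and adm: "admissible N0 s thr stk" "1 \<le> N0"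
    and size: "real N0 / \<epsilon> \<le> 2 ^ K" and i: "i = length stk"
    and r: "r = real_of_int (net_count s) / (2 ^ i * real N0)"
  shows "expected_error K x s stk \<le> \<epsilon> * (r + real i - (1 - 1 / 2 ^ i) / real N0)"
    and "r < 2" and "0 < i \<Longrightarrow> 3 / 4 \<le> r"
proof -
  have v: "valid_stream s" by (rule admissible_valid [OF adm(1)])
  have N: "0 \<le> net_count s" by (rule net_count_nonneg [OF v])
  have thr: "real_of_int thr = 2 ^ i * real N0"
    using linear_threshold [OF lin adm(1)] by (simp add: i)
  have "real_of_int (net_count s) < 2 * real_of_int thr"
    using admissible_less [OF adm(1)] lin by (simp add: W_linear_def field_simps)
  then show "r < 2" using adm(2) by (simp add: r thr field_simps)
  show "3 / 4 \<le> r" if pos: "0 < i"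
  proof -
    obtain c t rest where stk: "stk = (c, t) # rest"
      using pos i by (cases stk) auto
    have "real_of_int t = 2 ^ (i - 1) * real N0"
      using linear_threshold [OF lin, of N0 c t rest] adm(1) by (simp add: i stk)
    then have "2 * real_of_int t = real_of_int thr"
      using pos by (simp add: thr power_eq_if)
    moreover have "real_of_int (thr + t) \<le> real_of_int (2 * net_count s)"
      using admissible_ConsD(5) [of N0 s thr c t rest] adm(1) by (simp only: of_int_le_iff stk)
    ultimately have "3 / 4 * real_of_int thr \<le> real_of_int (net_count s)" by simp
    then show ?thesis using adm(2) by (simp add: r thr field_simps)
  qed
  \<comment> \<open>The sign matters because the factor N0/2^K is about to be replaced by the larger
    epsilon.\<close>
  have num: "0 \<le> r + real i - (1 - 1 / 2 ^ i) / real N0"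
  proof (cases "i = 0")
    case True
    then show ?thesis using N by (simp add: r)
  next
    case False
    have "(1 - 1 / 2 ^ i) / real N0 \<le> 1 / 1"
      using adm(2) by (intro frac_le) auto
    moreover have "0 \<le> r" using N by (simp add: r)
    ultimately show ?thesis using False by simp
  qed
  have N0: "0 < real N0" using adm(2) by simp
  have "expected_error K x s stk \<le>
      real_of_int (net_count s) / 2 ^ (K + i) + (real i * real N0 - (1 - 1 / 2 ^ i)) / 2 ^ K"
    unfolding expected_error_def i using others_le [OF v, of x] linear_overhead_le [OF lin adm(1)]
    by (intro add_mono divide_right_mono) auto
  also have "\<dots> = real N0 / 2 ^ K * (r + real i - (1 - 1 / 2 ^ i) / real N0)"
    using N0 by (simp add: r power_add field_simps)
  also have "\<dots> \<le> \<epsilon> * (r + real i - (1 - 1 / 2 ^ i) / real N0)"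
    using size lin(2) num by (intro mult_right_mono) (auto simp: field_simps)
  finally show "expected_error K x s stk \<le> \<epsilon> * (r + real i - (1 - 1 / 2 ^ i) / real N0)" .
qed

text \<open>Since log N = i + log N0 + log r, the expansions account for the summand i exactly, and
  it remains to compare r with log N0 + log r. This is delicate only for r below 1.\<close>

lemma linear_expected_error_le_log:
  assumes lin: "W = W_linear \<epsilon>" "0 < \<epsilon>" and adm: "admissible N0 s thr stk"
    and size: "real N0 / \<epsilon> \<le> 2 ^ K" and "2 \<le> net_count s" and N0: "2 \<le> N0"
  shows "expected_error K x s stk \<le> log 2 (real_of_int (net_count s)) * \<epsilon>"
proof -
  define i where "i = length stk"
  define r where "r = real_of_int (net_count s) / (2 ^ i * real N0)"
  have "1 \<le> N0" using N0 by simp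
  note bounds = linear_expected_error_le [OF lin adm this size i_def r_def]
  have r: "0 < r" using assms by (simp add: r_def)
  have "real_of_int (net_count s) = 2 ^ i * real N0 * r"
    using N0 by (simp add: r_def)
  then have log: "log 2 (real_of_int (net_count s)) = real i + log 2 (real N0) + log 2 r"
    using N0 r by (simp add: log_mult log_nat_power)
  have "1 \<le> log 2 (real N0)" using N0 by (simp add: le_log_iff)
  have "r - (1 - 1 / 2 ^ i) / real N0 \<le> log 2 (real N0) + log 2 r"
  proof (cases "1 \<le> r")
    case True
    then have "r - 1 \<le> log 2 r" using bounds(2) by (intro log2_ge_chord) auto
    moreover have "0 \<le> (1 - 1 / 2 ^ i) / real N0" by simp
    ultimately show ?thesis using \<open>1 \<le> log 2 (real N0)\<close> by linarith
  next
    case False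
    show ?thesis
    proof (cases "i = 0")
      case True
      have "1 \<le> log 2 (real_of_int (net_count s))" using assms by (simp add: le_log_iff)
      then show ?thesis using log True False by simp
    next
      case i: False
      then have r34: "3 / 4 \<le> r" using bounds(3) by simp
      then have chord: "2 * (r - 1) \<le> log 2 r" using False by (intro log2_ge_chord_half) auto
      show ?thesis
      proof (cases "N0 = 2")
        \<comment> \<open>At r = 3/4 the chord 2(r - 1) leaves exactly 1/4 missing, and the
          integrality term supplies it: (1 - 1/2)/2 = 1/4.\<close>
        case True
        have "(1 / 2) ^ i \<le> (1 / 2 :: real) ^ 1" using i by (intro power_decreasing) auto
        then have "1 / 2 ^ i \<le> (1 / 2 :: real)" by (simp add: power_one_over)
        moreover have "1 / 4 \<le> (1 - q) / real N0" if "q \<le> 1 / 2" for q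
          using that by (simp add: True)
        ultimately have "1 / 4 \<le> (1 - 1 / 2 ^ i) / real N0" by blast
        moreover have "r - q \<le> log 2 (real N0) + log 2 r" if "1 / 4 \<le> q" for q
          using that chord r34 \<open>1 \<le> log 2 (real N0)\<close> by argo
        ultimately show ?thesis by blast
      next
        case N0': False
        \<comment> \<open>3^2 >= 2^3 gives log_2 3 >= 3/2, enough without the integrality
          term.\<close>
        have "(3 :: real)\<^sup>2 \<le> (real N0)\<^sup>2" using N0 N0' by (intro power_mono) auto
        then have "3 \<le> log 2 ((real N0)\<^sup>2)" using N0 by (simp add: le_log_iff)
        then have "3 / 2 \<le> log 2 (real N0)" using N0 by (simp add: log_nat_power)
        then have "r - q \<le> log 2 (real N0) + log 2 r" if "0 \<le> q" for q
          using that chord r34 by argo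
        moreover have "0 \<le> (1 - 1 / 2 ^ i) / real N0" by simp
        ultimately show ?thesis by blast
      qed
    qed
  qed
  then have "\<epsilon> * (r + real i - (1 - 1 / 2 ^ i) / real N0)
      \<le> \<epsilon> * log 2 (real_of_int (net_count s))"
    using lin(2) log by (intro mult_left_mono) auto
  then show ?thesis using bounds(1) [of x] by (simp add: mult.commute)
qed

text \<open>Since r < 2 and i <= 1 + log N, the sum is at most 3 + log N, which is at most 4 log N
  for N >= 2.\<close>

lemma linear_expected_error_le_4_log:
  assumes lin: "W = W_linear \<epsilon>" "0 < \<epsilon>" and adm: "admissible N0 s thr stk" "1 \<le> N0"
    and size: "real N0 / \<epsilon> \<le> 2 ^ K" and N: "2 \<le> net_count s"
  shows "expected_error K x s stk \<le> 4 * log 2 (real_of_int (net_count s)) * \<epsilon>"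
proof -
  define i where "i = length stk"
  define r where "r = real_of_int (net_count s) / (2 ^ i * real N0)"
  let ?N = "real_of_int (net_count s)"
  note bounds = linear_expected_error_le [OF lin adm size i_def r_def]
  have log: "1 \<le> log 2 ?N" using N by (simp add: le_log_iff)
  have "real i \<le> 1 + log 2 ?N"
  proof (cases "i = 0")
    case True
    then show ?thesis using log by simp
  next
    case False
    then have "3 / 4 * (2 ^ i * real N0) \<le> ?N"
      using bounds(3) adm(2) by (simp add: r_def field_simps)
    moreover have "2 ^ i * 1 \<le> 2 ^ i * real N0" using adm(2) by (intro mult_left_mono) auto
    ultimately have "2 ^ i \<le> 2 * ?N" using N by linarith
    then have "real i \<le> log 2 (2 * ?N)" using N by (simp add: le_log_iff powr_realpow)
    then show ?thesis using N by (simp add: log_mult)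
  qed
  moreover have "0 \<le> (1 - 1 / 2 ^ i) / real N0" by simp
  ultimately have "r + real i - (1 - 1 / 2 ^ i) / real N0 \<le> 4 * log 2 ?N"
    using bounds(2) log by linarith
  then have "\<epsilon> * (r + real i - (1 - 1 / 2 ^ i) / real N0) \<le> \<epsilon> * (4 * log 2 ?N)"
    using lin(2) by (intro mult_left_mono) auto
  then show ?thesis using bounds(1) [of x] by (simp add: mult_ac)
qed

end

section \<open>The sublinear size functions\<close>

lemma size_function_sublinear:
  assumes "0 \<le> \<alpha>" "\<alpha> < 1" "0 < \<epsilon>"
  shows "size_function (W_sublinear \<alpha> \<epsilon>)"
proof
  fix a b :: real
  assume "0 \<le> a" "a \<le> b"
  then show "W_sublinear \<alpha> \<epsilon> a \<le> W_sublinear \<alpha> \<epsilon> b"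
    using assms by (simp add: W_sublinear_def divide_right_mono powr_mono2)
next
  fix a b :: real
  assume ab: "1 \<le> a" "0 \<le> b" "2 * W_sublinear \<alpha> \<epsilon> a \<le> W_sublinear \<alpha> \<epsilon> b"
  show "2 * a \<le> b"
  proof (rule ccontr)
    assume "\<not> 2 * a \<le> b"
    then have "b powr \<alpha> \<le> (2 * a) powr \<alpha>" using ab assms by (intro powr_mono2) auto
    also have "\<dots> = 2 powr \<alpha> * a powr \<alpha>" using ab by (simp add: powr_mult)
    also have "\<dots> < 2 powr 1 * a powr \<alpha>"
      using ab assms by (intro mult_strict_right_mono powr_less_mono) auto
    finally show False using ab assms by (simp add: W_sublinear_def field_simps)
  qed
qed

context size_function
begin

text \<open>\<open>W\<close> doubles when the count grows by the factor beta, but thresholds are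
  integers and each is rounded up. The rounding errors are absorbed by proving 2X - 1 instead of 2X,
  where X is the ideal threshold: beta (2X - 1) + 1 <= 2 beta X - 1 because beta >= 2.\<close>

lemma sublinear_threshold:
  assumes W: "W = W_sublinear \<alpha> \<epsilon>" "0 < \<epsilon>" and \<alpha>: "0 < \<alpha>" "\<alpha> < 1"
    and \<beta>: "\<beta> = 2 powr (1 / \<alpha>)"
    and adm: "admissible N0 s thr stk" "1 \<le> N0"
  shows "\<beta> ^ length stk * real N0 \<le> real_of_int thr"
    and "real_of_int thr \<le> 2 * \<beta> ^ length stk * real N0 - 1"
    and "real_of_int (net_count s) < \<beta> * real_of_int thr"
proof -
  have \<beta>2: "2 \<le> \<beta>"
  proof -
    have "(2 :: real) powr 1 \<le> 2 powr (1 / \<alpha>)" using \<alpha> by (intro powr_mono) auto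
    then show ?thesis by (simp add: \<beta>)
  qed
  have double: "2 * b powr \<alpha> = (\<beta> * b) powr \<alpha>" if "0 \<le> b" for b
    using that \<alpha> by (simp add: powr_mult \<beta> powr_powr)
  have less: "real_of_int (net_count s) < \<beta> * real_of_int thr"
    if "admissible N0 s thr stk" for s :: "'b stream" and thr stk
  proof (rule ccontr)
    assume "\<not> ?thesis"
    moreover have "1 \<le> thr" by (rule admissible_threshold_pos [OF that adm(2)])
    ultimately have "(\<beta> * real_of_int thr) powr \<alpha> \<le> real_of_int (net_count s) powr \<alpha>"
      using \<beta>2 \<alpha> by (intro powr_mono2) auto
    then show False
      using admissible_less [OF that] W double [of "real_of_int thr"] \<open>1 \<le> thr\<close>
      by (simp add: W_sublinear_def field_simps)
  qed
  show "real_of_int (net_count s) < \<beta> * real_of_int thr" by (rule less [OF adm(1)])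
  have "\<beta> ^ length stk * real N0 \<le> real_of_int thr \<and>
      real_of_int thr \<le> 2 * \<beta> ^ length stk * real N0 - 1"
    using adm(1)
  proof (induction stk arbitrary: s thr)
    case Nil
    then show ?case using adm(2) by simp
  next
    case (Cons p stk)
    obtain c t where p: "p = (c, t)" by (cases p)
    have adm': "admissible N0 s thr ((c, t) # stk)" using Cons.prems unfolding p .
    have IH: "\<beta> ^ length stk * real N0 \<le> real_of_int t"
      "real_of_int t \<le> 2 * \<beta> ^ length stk * real N0 - 1"
      using Cons.IH [of c t] adm' by auto
    have t1: "1 \<le> t" using adm' admissible_threshold_pos adm(2) by auto
    have thr1: "1 \<le> thr" by (rule admissible_threshold_pos [OF adm' adm(2)])
    have "\<beta> * real_of_int t \<le> real_of_int thr"
    proof (rule ccontr)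
      assume "\<not> ?thesis"
      then have "real_of_int thr powr \<alpha> < (\<beta> * real_of_int t) powr \<alpha>"
        using thr1 \<alpha> by (intro powr_less_mono2) auto
      then show False
        using admissible_ConsD(4) [OF adm'] W(2) double [of "real_of_int t"] t1
        by (simp add: W(1) W_sublinear_def field_simps)
    qed
    moreover have "\<beta> * (\<beta> ^ length stk * real N0) \<le> \<beta> * real_of_int t"
      using IH \<beta>2 by (intro mult_left_mono) auto
    ultimately have lower: "\<beta> ^ length (p # stk) * real N0 \<le> real_of_int thr"
      by (simp add: mult.assoc)
    have "real_of_int thr < \<beta> * real_of_int t + 1"
      using less [OF admissible_ConsD(2) [OF adm']] admissible_ConsD(3) [OF adm'] by simp
    also have "\<dots> \<le> \<beta> * (2 * \<beta> ^ length stk * real N0 - 1) + 1"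
      using IH \<beta>2 by (intro add_right_mono mult_left_mono) auto
    also have "\<dots> \<le> 2 * \<beta> ^ length (p # stk) * real N0 - 1"
      using \<beta>2 by (simp add: algebra_simps)
    finally show ?case using lower by simp
  qed
  then show "\<beta> ^ length stk * real N0 \<le> real_of_int thr"
    "real_of_int thr \<le> 2 * \<beta> ^ length stk * real N0 - 1" by auto
qed

text \<open>With \<open>\<gamma> = \<beta> / 2\<close>, the \<open>k\<close>-th expansion adds at most
  \<open>2 \<gamma>\<^sup>k N0 / w0\<close>; the geometric sum is dominated by its last term since \<open>\<gamma> > 1\<close>.\<close>

lemma sublinear_overhead_le:
  assumes W: "W = W_sublinear \<alpha> \<epsilon>" "0 < \<epsilon>" and \<alpha>: "0 < \<alpha>" "\<alpha> < 1"
    and \<beta>: "\<beta> = 2 powr (1 / \<alpha>)" and \<gamma>: "\<gamma> = \<beta> / 2" and D: "D = 2 * \<gamma> / (\<gamma> - 1)"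
    and adm: "admissible N0 s thr stk" "1 \<le> N0"
  shows "overhead K x stk \<le> D * (\<gamma> ^ length stk - 1) * real N0 / 2 ^ K"
  using adm(1)
proof (induction stk arbitrary: s thr)
  case (Cons p stk)
  obtain c t where p: "p = (c, t)" by (cases p)
  let ?i = "length stk"
  have adm': "admissible N0 s thr ((c, t) # stk)" using Cons.prems unfolding p .
  have \<gamma>1: "1 < \<gamma>"
  proof -
    have "(2 :: real) powr 1 < 2 powr (1 / \<alpha>)" using \<alpha> by (intro powr_less_mono) auto
    then show ?thesis by (simp add: \<beta> \<gamma>)
  qed
  have "others x c \<le> thr - 1"
    using others_le [OF admissible_ConsD(1) [OF adm'], of x] admissible_ConsD(3) [OF adm'] by simp
  then have "real_of_int (others x c) \<le> real_of_int thr - 1" by linarith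
  also have "\<dots> \<le> 2 * \<beta> ^ Suc ?i * real N0"
    using sublinear_threshold(2) [OF W \<alpha> \<beta> adm' adm(2)] by simp
  finally have "real_of_int (others x c) / 2 ^ Suc (K + ?i)
      \<le> 2 * \<beta> ^ Suc ?i * real N0 / 2 ^ Suc (K + ?i)"
    by (intro divide_right_mono) auto
  also have "\<dots> = 2 * \<gamma> ^ Suc ?i * real N0 / 2 ^ K"
    by (simp add: \<gamma> power_add power_divide mult_ac)
  \<comment> \<open>\<open>D\<close> is chosen so that the summand is D (gamma^(i+1) - gamma^i) up
    to the common factor, and the sum telescopes.\<close>
  also have "2 * \<gamma> ^ Suc ?i = D * (\<gamma> - 1) * \<gamma> ^ ?i"
    using \<gamma>1 by (simp add: D)
  finally have "overhead K x (p # stk) \<le> D * (\<gamma> ^ ?i - 1) * real N0 / 2 ^ K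
      + D * (\<gamma> - 1) * \<gamma> ^ ?i * real N0 / 2 ^ K"
    using Cons.IH [of c t] adm' by (simp add: p)
  also have "\<dots> = D * (\<gamma> ^ Suc ?i - 1) * real N0 / 2 ^ K"
    by (simp add: add_divide_distrib [symmetric]) (simp add: algebra_simps)
  finally show ?case by simp
qed simp

text \<open>The array has at least \<open>W(X)\<close> counters for the ideal threshold X. The 4
  bounds (2 beta)^alpha, from N < 2 beta X; the factor 2 of \<open>D\<close> bounds 2^(1 - alpha),
  from X <= 2N once an expansion is in force.\<close>

lemma sublinear_expected_error_le:
  assumes W: "W = W_sublinear \<alpha> \<epsilon>" "0 < \<epsilon>" and \<alpha>: "0 < \<alpha>" "\<alpha> < 1"
    and \<beta>: "\<beta> = 2 powr (1 / \<alpha>)" and \<gamma>: "\<gamma> = \<beta> / 2" and D: "D = 2 * \<gamma> / (\<gamma> - 1)"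
    and adm: "admissible N0 s thr stk" "1 \<le> N0" and size: "real N0 powr \<alpha> / \<epsilon> \<le> 2 ^ K"
  shows "expected_error K x s stk
    \<le> (4 + 2 * D) * (\<epsilon> * real_of_int (net_count s) powr (1 - \<alpha>))"
proof -
  define i where "i = length stk"
  let ?N = "real_of_int (net_count s)"
  define X where "X = \<beta> ^ i * real N0"
  have v: "valid_stream s" by (rule admissible_valid [OF adm(1)])
  have N: "0 \<le> net_count s" by (rule net_count_nonneg [OF v])
  have \<beta>2: "2 < \<beta>"
  proof -
    have "(2 :: real) powr 1 < 2 powr (1 / \<alpha>)" using \<alpha> by (intro powr_less_mono) auto
    then show ?thesis by (simp add: \<beta>)
  qed
  have D0: "0 \<le> D" using \<beta>2 by (simp add: D \<gamma>)
  have X: "0 < X" using \<beta>2 adm(2) by (simp add: X_def)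
  have \<beta>\<alpha>: "\<beta> powr \<alpha> = 2" using \<alpha> by (simp add: \<beta> powr_powr)
  have "X powr \<alpha> = 2 ^ i * real N0 powr \<alpha>"
  proof -
    have "(\<beta> ^ i) powr \<alpha> = (\<beta> powr \<alpha>) ^ i"
      using \<beta>2 by (simp add: powr_realpow [symmetric] powr_powr mult.commute)
    then show ?thesis using \<beta>2 by (simp add: X_def powr_mult \<beta>\<alpha>)
  qed
  also have "\<dots> \<le> 2 ^ i * (\<epsilon> * 2 ^ K)"
    using size W(2) by (intro mult_left_mono) (auto simp: field_simps)
  finally have X\<alpha>: "X powr \<alpha> \<le> \<epsilon> * 2 ^ (K + i)" by (simp add: power_add mult_ac)
  have inv: "1 / 2 ^ (K + i) \<le> \<epsilon> / X powr \<alpha>"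
    using X\<alpha> X by (simp add: field_simps)
  have thr: "X \<le> real_of_int thr" "real_of_int thr \<le> 2 * X" "?N < \<beta> * real_of_int thr"
    using sublinear_threshold [OF W \<alpha> \<beta> adm] by (auto simp: X_def i_def)

  have first: "real_of_int (others x s) / 2 ^ (K + i) \<le> 4 * (\<epsilon> * ?N powr (1 - \<alpha>))"
  proof (cases "net_count s = 0")
    case True
    then have "real_of_int (others x s) / 2 ^ (K + i) \<le> 0"
      using others_le [OF v, of x] by (simp add: divide_le_0_iff)
    then show ?thesis using W(2) by (simp add: True)
  next
    case False
    then have N1: "0 < ?N" using N by simp
    have "?N powr \<alpha> \<le> (2 * \<beta> * X) powr \<alpha>"
    proof (rule powr_mono2)
      have "\<beta> * real_of_int thr \<le> \<beta> * (2 * X)" using thr \<beta>2 by (intro mult_left_mono) auto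
      then show "?N \<le> 2 * \<beta> * X" using thr by simp
    qed (use N \<alpha> in auto)
    also have "\<dots> = 2 powr \<alpha> * 2 * X powr \<alpha>" using \<beta>2 X by (simp add: powr_mult \<beta>\<alpha>)
    also have "\<dots> \<le> 2 powr 1 * 2 * X powr \<alpha>"
      using \<alpha> by (intro mult_right_mono powr_mono) auto
    finally have "?N powr \<alpha> \<le> 4 * X powr \<alpha>" by simp
    then have *: "1 / X powr \<alpha> \<le> 4 / ?N powr \<alpha>" using X N1 by (simp add: field_simps)
    have "real_of_int (others x s) / 2 ^ (K + i) \<le> ?N * (1 / 2 ^ (K + i))"
      using others_le [OF v, of x] by (simp add: divide_right_mono)
    also have "\<dots> \<le> ?N * (\<epsilon> * (1 / X powr \<alpha>))" using inv N by (intro mult_left_mono) auto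
    also have "\<dots> \<le> ?N * (\<epsilon> * (4 / ?N powr \<alpha>))"
      using * N W(2) by (intro mult_left_mono) auto
    also have "\<dots> = 4 * (\<epsilon> * ?N powr (1 - \<alpha>))" using N1 by (simp add: powr_diff)
    finally show ?thesis .
  qed
  have second: "overhead K x stk \<le> 2 * D * (\<epsilon> * ?N powr (1 - \<alpha>))"
  proof (cases stk)
    case Nil
    then show ?thesis using D0 W(2) by simp
  next
    case (Cons p rest)
    obtain c t where p: "p = (c, t)" by (cases p)
    have "1 \<le> t" using adm admissible_threshold_pos by (auto simp: Cons p)
    then have "thr \<le> 2 * net_count s" using adm by (auto simp: Cons p)
    then have XN: "X \<le> 2 * ?N" using thr(1) by linarith
    have "overhead K x stk \<le> D * (\<gamma> ^ i - 1) * real N0 / 2 ^ K"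
      using sublinear_overhead_le [OF W \<alpha> \<beta> \<gamma> D adm] by (simp add: i_def)
    also have "\<dots> \<le> D * \<gamma> ^ i * real N0 / 2 ^ K"
      using D0 by (intro divide_right_mono mult_right_mono mult_left_mono) auto
    also have "\<dots> = D * (X * (1 / 2 ^ (K + i)))"
      by (simp add: X_def \<gamma> power_divide power_add mult_ac)
    also have "\<dots> \<le> D * (X * (\<epsilon> / X powr \<alpha>))"
      using inv X D0 by (intro mult_left_mono) auto
    also have "\<dots> = D * (\<epsilon> * X powr (1 - \<alpha>))" using X by (simp add: powr_diff)
    also have "\<dots> \<le> D * (\<epsilon> * (2 * ?N) powr (1 - \<alpha>))"
      using XN X \<alpha> D0 W(2) by (intro mult_left_mono powr_mono2) auto
    also have "\<dots> = D * (\<epsilon> * (2 powr (1 - \<alpha>) * ?N powr (1 - \<alpha>)))"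
      using N by (simp add: powr_mult)
    also have "\<dots> \<le> D * (\<epsilon> * (2 powr 1 * ?N powr (1 - \<alpha>)))"
      using \<alpha> D0 W(2) by (intro mult_left_mono mult_right_mono powr_mono) auto
    finally show ?thesis by simp
  qed
  from first second show ?thesis by (simp add: expected_error_def i_def algebra_simps)
qed

text \<open>For alpha = 0 the growth factor 2^(1/alpha) is meaningless, but \<open>W\<close> is
  constant on positive counts and never doubles, so the stack is empty.\<close>

lemma constant_expected_error_le:
  assumes W: "W = W_sublinear 0 \<epsilon>" "0 < \<epsilon>"
    and adm: "admissible N0 s thr stk" "1 \<le> N0" and size: "1 / \<epsilon> \<le> 2 ^ K"
  shows "expected_error K x s stk \<le> \<epsilon> * real_of_int (net_count s)"
proof -
  have v: "valid_stream s" by (rule admissible_valid [OF adm(1)])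
  have "stk = []"
  proof (cases stk)
    case (Cons p rest)
    obtain c t where p: "p = (c, t)" by (cases p)
    \<comment> \<open>Positive thresholds matter here, as \<open>0 powr 0\<close> is 0.\<close>
    have "1 \<le> t" "1 \<le> thr" "2 * W (real_of_int t) \<le> W (real_of_int thr)"
      using adm admissible_threshold_pos [OF adm] admissible_threshold_pos [of N0 c t rest]
      by (auto simp: Cons p)
    then show ?thesis using W by (simp add: W_sublinear_def field_simps)
  qed
  then have "expected_error K x s stk = real_of_int (others x s) * (1 / 2 ^ K)"
    by (simp add: expected_error_def)
  also have "\<dots> \<le> real_of_int (net_count s) * \<epsilon>"
    using others_le [OF v, of x] net_count_nonneg [OF v] size W(2)
    by (intro mult_mono) (auto simp: field_simps)
  finally show ?thesis by (simp add: mult.commute)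
qed

end

text \<open>Fixes the constant before epsilon, \<open>N0\<close>, the initial size and the stream,
  so that it depends on alpha alone.\<close>

lemma sublinear_error_constant:
  assumes "0 \<le> \<alpha>" "\<alpha> < 1"
  obtains B where "2 \<le> B"
    "\<And>\<epsilon> N0 K (s :: 'k stream) thr stk x. 0 < \<epsilon> \<Longrightarrow> 1 \<le> N0 \<Longrightarrow>
      W_sublinear \<alpha> \<epsilon> (real N0) \<le> 2 ^ K \<Longrightarrow>
      size_function.admissible (W_sublinear \<alpha> \<epsilon>) N0 s thr stk \<Longrightarrow>
      expected_error K x s stk \<le> B * (\<epsilon> * real_of_int (net_count s) powr (1 - \<alpha>))"
proof (cases "\<alpha> = 0")
  case True
  have "expected_error K x s stk \<le> 2 * (\<epsilon> * real_of_int (net_count s) powr (1 - \<alpha>))"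
    if *: "0 < \<epsilon>" "1 \<le> N0" "W_sublinear \<alpha> \<epsilon> (real N0) \<le> 2 ^ K"
      "size_function.admissible (W_sublinear \<alpha> \<epsilon>) N0 s thr stk"
    for \<epsilon> N0 K and s :: "'k stream" and thr stk x
  proof -
    interpret size_function "W_sublinear \<alpha> \<epsilon>" by (rule size_function_sublinear [OF assms *(1)])
    have N: "0 \<le> net_count s" using net_count_nonneg [OF admissible_valid [OF *(4)]] .
    have "expected_error K x s stk \<le> \<epsilon> * real_of_int (net_count s)"
      by (rule constant_expected_error_le [OF _ *(1) *(4,2)])
        (use * True in \<open>auto simp: W_sublinear_def\<close>)
    also have "\<dots> \<le> 2 * \<dots>"
    proof -
      have "0 \<le> \<epsilon> * real_of_int (net_count s)" using N *(1) by simp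
      then show ?thesis by linarith
    qed
    finally show ?thesis using N by (simp add: True)
  qed
  then show ?thesis using that [of 2] by simp
next
  case False
  define \<beta> :: real where "\<beta> = 2 powr (1 / \<alpha>)"
  define \<gamma> where "\<gamma> = \<beta> / 2"
  define D where "D = 2 * \<gamma> / (\<gamma> - 1)"
  have \<alpha>: "0 < \<alpha>" using assms False by simp
  have "(2 :: real) powr 1 < 2 powr (1 / \<alpha>)" using \<alpha> assms by (intro powr_less_mono) auto
  then have "0 \<le> D" by (simp add: D_def \<gamma>_def \<beta>_def)
  moreover have "expected_error K x s stk
      \<le> (4 + 2 * D) * (\<epsilon> * real_of_int (net_count s) powr (1 - \<alpha>))"
    if *: "0 < \<epsilon>" "1 \<le> N0" "W_sublinear \<alpha> \<epsilon> (real N0) \<le> 2 ^ K"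
      "size_function.admissible (W_sublinear \<alpha> \<epsilon>) N0 s thr stk"
    for \<epsilon> N0 K and s :: "'k stream" and thr stk x
  proof -
    interpret size_function "W_sublinear \<alpha> \<epsilon>" by (rule size_function_sublinear [OF assms *(1)])
    show ?thesis
      by (rule sublinear_expected_error_le [OF refl *(1) \<alpha> assms(2) \<beta>_def \<gamma>_def D_def *(4,2)])
        (use *(3) in \<open>simp add: W_sublinear_def\<close>)
  qed
  ultimately show ?thesis using that [of "4 + 2 * D"] by simp
qed

section \<open>Assembly of the two bounds and the comparison with the upfront sketch\<close>

theorem theorem4p1:
  fixes \<alpha> :: real
  assumes "0 \<le> \<alpha>" and "\<alpha> < 1"
  shows
    "(\<exists>C>0. \<forall>\<epsilon> w0 N0 (M :: 'w measure) h (s :: 'k stream) x.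
        0 < \<epsilon> \<and> initial_size (W_sublinear \<alpha> \<epsilon>) w0 N0 \<and> bitstring_hash M h \<and> valid_stream s \<longrightarrow>
        (let W = W_sublinear \<alpha> \<epsilon>;
             N = key_count s;
             err = sublime_expected_error W w0 N0 M h s x
         in err \<le> C * (\<epsilon> * real_of_int N powr (1 - \<alpha>)) \<and>
            (\<forall>(M' :: 'v measure) g. pairwise_hash M' (upfront_size W N) g \<longrightarrow>
               err \<le> C * cms_error_term M' (upfront_size W N) (g :: 'v \<Rightarrow> 'k \<Rightarrow> nat) N)))
     \<and>
     (\<exists>C>0. \<forall>\<epsilon> w0 N0 (M :: 'w measure) h (s :: 'k stream) x.
        0 < \<epsilon> \<and> initial_size (W_linear \<epsilon>) w0 N0 \<and> bitstring_hash M h \<and> valid_stream s \<and>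
        2 \<le> key_count s \<longrightarrow>
        (let W = W_linear \<epsilon>;
             N = key_count s;
             err = sublime_expected_error W w0 N0 M h s x
         in (2 \<le> N0 \<longrightarrow> err \<le> log 2 (real_of_int N) * \<epsilon>) \<and>
            err \<le> C * (log 2 (real_of_int N) * \<epsilon>) \<and>
            (\<forall>(M' :: 'v measure) g. pairwise_hash M' (upfront_size W N) g \<longrightarrow>
               err \<le> C * log 2 (real_of_int N) *
                 cms_error_term M' (upfront_size W N) (g :: 'v \<Rightarrow> 'k \<Rightarrow> nat) N)))"
    (is "?sublinear \<and> ?linear")
proof
  obtain B where B: "2 \<le> B"
    "\<And>\<epsilon> N0 K (s :: 'k stream) thr stk x. 0 < \<epsilon> \<Longrightarrow> 1 \<le> N0 \<Longrightarrow>
      W_sublinear \<alpha> \<epsilon> (real N0) \<le> 2 ^ K \<Longrightarrow>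
      size_function.admissible (W_sublinear \<alpha> \<epsilon>) N0 s thr stk \<Longrightarrow>
      expected_error K x s stk \<le> B * (\<epsilon> * real_of_int (net_count s) powr (1 - \<alpha>))"
    using sublinear_error_constant [OF assms, where 'k = 'k] by metis
  have "sublime_expected_error (W_sublinear \<alpha> \<epsilon>) w0 N0 M h s x
        \<le> 2 * B * (\<epsilon> * real_of_int (key_count s) powr (1 - \<alpha>)) \<and>
      (\<forall>(M' :: 'v measure) (g :: 'v \<Rightarrow> 'k \<Rightarrow> nat).
        pairwise_hash M' (upfront_size (W_sublinear \<alpha> \<epsilon>) (key_count s)) g \<longrightarrow>
        sublime_expected_error (W_sublinear \<alpha> \<epsilon>) w0 N0 M h s x
        \<le> 2 * B * cms_error_term M' (upfront_size (W_sublinear \<alpha> \<epsilon>) (key_count s)) g (key_count s))"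
    if hyps: "0 < \<epsilon>" "initial_size (W_sublinear \<alpha> \<epsilon>) w0 N0" "bitstring_hash M h" "valid_stream s"
    for \<epsilon> w0 N0 and M :: "'w measure" and h and s :: "'k stream" and x
  proof -
    interpret size_function "W_sublinear \<alpha> \<epsilon>" by (rule size_function_sublinear [OF assms hyps(1)])
    obtain K where K: "w0 = 2 ^ K" "1 \<le> N0" "W_sublinear \<alpha> \<epsilon> (real N0) \<le> 2 ^ K"
      using hyps(2) by (auto simp: initial_size_def)
    obtain thr stk where adm: "admissible N0 s thr stk" and
      err: "sublime_expected_error (W_sublinear \<alpha> \<epsilon>) w0 N0 M h s x = expected_error K x s stk"
      using sublime_expected_error_eq [OF hyps(4) K(2) hyps(3)] K(1) by metis
    let ?N = "real_of_int (net_count s)"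
    have N: "0 \<le> net_count s" by (rule net_count_nonneg [OF hyps(4)])
    have le: "expected_error K x s stk \<le> B * (\<epsilon> * ?N powr (1 - \<alpha>))"
      by (rule B(2) [OF hyps(1) K(2,3) adm])
    also have "\<dots> \<le> 2 * B * (\<epsilon> * ?N powr (1 - \<alpha>))"
      using B(1) hyps(1) by (intro mult_right_mono) auto
    finally have le2: "expected_error K x s stk \<le> 2 * B * (\<epsilon> * ?N powr (1 - \<alpha>))" .
    moreover have "expected_error K x s stk
        \<le> 2 * B * cms_error_term M' (upfront_size (W_sublinear \<alpha> \<epsilon>) (net_count s)) g (net_count s)"
      if hash: "pairwise_hash M' (upfront_size (W_sublinear \<alpha> \<epsilon>) (net_count s)) g"
      for M' :: "'v measure" and g :: "'v \<Rightarrow> 'k \<Rightarrow> nat"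
    \<comment> \<open>For N = 0 the value \<open>W(0)\<close> is 0 and the ratio N/W(N) says
      nothing, but the error bound itself is then 0.\<close>
    proof (cases "net_count s = 0")
      case True
      have "expected_error K x s stk \<le> 0" using le2 by (simp add: True)
      also have "0 \<le> 2 * B *
          cms_error_term M' (upfront_size (W_sublinear \<alpha> \<epsilon>) (net_count s)) g (net_count s)"
        using B(1) cms_error_term_nonneg [OF hash \<open>valid_stream s\<close> refl] by simp
      finally show ?thesis .
    next
      case False
      then have "0 < ?N" using N by simp
      then have "\<epsilon> * ?N powr (1 - \<alpha>) = ?N / W_sublinear \<alpha> \<epsilon> ?N" "0 < W_sublinear \<alpha> \<epsilon> ?N"
        using \<open>0 < \<epsilon>\<close> by (simp_all add: W_sublinear_def powr_diff)
      then show ?thesis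
        using expected_error_le_cms [OF adm K(2) _ B(1) refl _ hash] le by simp
    qed
    ultimately show ?thesis by (auto simp: err key_count_eq_net_count)
  qed
  then show ?sublinear
    using B(1) by (intro exI [of _ "2 * B"]) (simp add: Let_def)
next
  have "(2 \<le> N0 \<longrightarrow> sublime_expected_error (W_linear \<epsilon>) w0 N0 M h s x
          \<le> log 2 (real_of_int (key_count s)) * \<epsilon>) \<and>
      sublime_expected_error (W_linear \<epsilon>) w0 N0 M h s x
        \<le> 8 * (log 2 (real_of_int (key_count s)) * \<epsilon>) \<and>
      (\<forall>(M' :: 'v measure) (g :: 'v \<Rightarrow> 'k \<Rightarrow> nat).
        pairwise_hash M' (upfront_size (W_linear \<epsilon>) (key_count s)) g \<longrightarrow>
        sublime_expected_error (W_linear \<epsilon>) w0 N0 M h s x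
        \<le> 8 * log 2 (real_of_int (key_count s)) *
          cms_error_term M' (upfront_size (W_linear \<epsilon>) (key_count s)) g (key_count s))"
    if hyps: "0 < \<epsilon>" "initial_size (W_linear \<epsilon>) w0 N0" "bitstring_hash M h" "valid_stream s"
      "2 \<le> key_count s"
    for \<epsilon> w0 N0 and M :: "'w measure" and h and s :: "'k stream" and x
  proof -
    interpret size_function "W_linear \<epsilon>" by (rule size_function_linear [OF hyps(1)])
    obtain K where K: "w0 = 2 ^ K" "1 \<le> N0" "real N0 / \<epsilon> \<le> 2 ^ K"
      using hyps(2) by (auto simp: initial_size_def W_linear_def)
    obtain thr stk where adm: "admissible N0 s thr stk" and
      err: "sublime_expected_error (W_linear \<epsilon>) w0 N0 M h s x = expected_error K x s stk"
      using sublime_expected_error_eq [OF hyps(4) K(2) hyps(3)] K(1) by metis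
    let ?N = "real_of_int (net_count s)"
    have N: "2 \<le> net_count s" using hyps(5) by (simp add: key_count_eq_net_count)
    have log: "1 \<le> log 2 ?N" using N by (simp add: le_log_iff)
    have le: "expected_error K x s stk \<le> 4 * log 2 ?N * \<epsilon>"
      by (rule linear_expected_error_le_4_log [OF refl hyps(1) adm K(2,3) N])
    also have "\<dots> \<le> 8 * (log 2 ?N * \<epsilon>)"
      using log hyps(1) mult_nonneg_nonneg [of "log 2 ?N" \<epsilon>] by simp
    finally have le8: "expected_error K x s stk \<le> 8 * (log 2 ?N * \<epsilon>)" .
    moreover have "expected_error K x s stk \<le> log 2 ?N * \<epsilon>" if "2 \<le> N0"
      by (rule linear_expected_error_le_log [OF refl \<open>0 < \<epsilon>\<close> adm K(3) N that])
    moreover have "expected_error K x s stk \<le> 8 * log 2 ?N *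
        cms_error_term M' (upfront_size (W_linear \<epsilon>) (net_count s)) g (net_count s)"
      if hash: "pairwise_hash M' (upfront_size (W_linear \<epsilon>) (net_count s)) g"
      for M' :: "'v measure" and g :: "'v \<Rightarrow> 'k \<Rightarrow> nat"
    proof -
      \<comment> \<open>As epsilon is N/W(N), the comparison applies with 4 log N in the role of its
        constant \<open>B\<close>; its factor 2 for rounding explains the 8.\<close>
      have "\<epsilon> = ?N / W_linear \<epsilon> ?N" "0 < W_linear \<epsilon> ?N"
        using \<open>0 < \<epsilon>\<close> N by (simp_all add: W_linear_def)
      then show ?thesis
        using expected_error_le_cms [OF adm K(2) _ _ refl _ hash, of K x "4 * log 2 ?N"] le log
        by simp
    qed
    ultimately show ?thesis by (auto simp: err key_count_eq_net_count)
  qed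
  then show ?linear
    by (intro exI [of _ 8]) (simp add: Let_def)
qed

end
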